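(* Let $\Omega\subset\mathbb C$ be a bounded simply connected domain bounded by a Jordan curve $\Gamma$, and let $p_0\in\Omega$ be a fixed point. Let $\{\Omega_n\}$ be a nested sequence of Jordan disks in $\Omega$ with polygonal boundaries $\Theta_n$ converging to $p_0$, i.e. $\Omega_1\supset\Omega_2\supset\cdots$, the diameter of $\Omega_n$ tends to $0$, and $\bigcap_n\Omega_n=\{p_0\}$. For each $n$ let $\mathcal A_n=\Omega\setminus\Omega_n$, an annulus with $\partial\mathcal A_n=\Gamma\cup\Theta_n$, endowed with a sequence of quasi-uniform triangulations $\{\mathcal T_{m,\mathcal A_n}\}_{m=1}^\infty$ of mesh size tending to $0$, by nonobtuse triangles, such that for all $m=m(\mathcal A_n)$ large enough the number of neighbors of vertices is uniformly bounded and, for each edge $[x_i,x_j]$ with common Voronoi side $\Gamma_{i,j}$, the point $[x_i,x_j]\cap\Gamma_{i,j}$ is the midpoint of $\Gamma_{i,j}$. Let $$\Phi_n:\mathcal A_n\to\mathcal E_n$$ be the conformal homeomorphisms constructed as limits of the discrete maps associated with $\{\mathcal T_{m,\mathcal A_n}\}_m$, onto the interior of the concentric Euclidean annuli $\mathcal E_n$ whose inner and outer radii are, respectively, $$R_1=1,\qquad R_{2,n}=\exp\Big(\frac{2\pi}{\mathrm{period}(u_n^{*})}\Big),$$ where $u_n^{*}$ is the harmonic conjugate of $u_n$, the solution of $\Delta u_n=0$ in $\mathcal A_n$, $u_n=1$ on $\Gamma$, $u_n=0$ on $\Theta_n$. Let $\sigma(z)=1/z$. Then a normalized subsequence of $\{\sigma\circ\Phi_n\}$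 converges uniformly on compact subsets of $\Omega\setminus\{p_0\}$ to a holomorphic homeomorphism $\Psi$ from $\Omega\setminus\{p_0\}$ onto $\mathbb D\setminus\{0\}$. Furthermore, $\Psi$ can be extended to be holomorphic over $\Omega$.
   Context: $\mathbb D$ is the open unit disk. Normalization. Fix a point $z_0\in\mathcal A_1$ with a local complex parameter at $z_0$, and a fixed $\xi_0\in\mathbb C$. The maps $\sigma\circ\Phi_n$ are normalized by post-composing with conformal embeddings $f_n:\sigma(\mathcal E_n)\to\mathbb C$, whose images are again Euclidean annuli bounded by two concentric circles, so that $\Xi_n=f_n\circ\sigma\circ\Phi_n$ satisfies $\Xi_n(z_0)=\xi_0$ and $\Xi_n'(z_0)=1$. Harmonic conjugate and period. $u_n^{*}(z)=u_n^{*}(a)+\int_\gamma\frac{\partial u_n}{\partial\hat n}ds$ for a simple piecewise smooth curve $\gamma\subset\mathcal A_n$ from a base point $a$ to $z$, with $\hat n$ the unit normal pointing to the right of the tangent (multivalued); $\mathrm{period}(u_n^{*})=\int_\beta\frac{\partial u_n}{\partial\hat n}ds$ for any simple closed counterclockwise piecewise smooth $\beta\subset\mathcal A_n$ of winding number 1. One has $\Phi_n=\exp\big(\frac{2\pi}{\mathrm{period}(u_n^{*})}(u_n+iu_n^{*})\big)$. Triangulations and Voronoi cells. A triangulation of a polygonal annulus is a finite set of closed triangles whose union is its closure, distinct ones meeting in the empty set, a vertex or one common edge. Quasi-uniform means that the ratio of the diameter of a triangle to the diameter of its largest inscribed circle is bounded by a fixed $\tau$ for all triangles in all triangulations of the sequence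 with small enough mesh size, the mesh size being the maximal diameter of a triangle. Voronoi cells are obtained by joining circumcenters of triangles sharing an edge; $\Gamma_{i,j}$ is the common side of the cells of the adjacent vertices $x_i,x_j$. If $\Gamma$ is not polygonal, the discrete approximation of $\Phi_n$ is understood via approximating from the inside by an increasing sequence of polygonal annuli carrying such triangulations. Discrete maps (on a polygonal annulus $\mathcal B$ with outer boundary $E_1$, inner boundary $E_2$, triangulated by $\mathcal T$). Edges have conductance $c(x_i,x_j)=\mathrm{length}(\Gamma_{i,j})/|x_i-x_j|$. With $\tilde h\in C^2(\mathcal B)\cap C^0(\bar{\mathcal B})$, $\tilde h=1$ on $E_1$, $\tilde h=0$ on $E_2$, $0\neq\Delta\tilde h\in L^2(\mathcal B)$, let $\tilde v$ be the finite element approximation of the solution of $\Delta\tilde u=-\Delta\tilde h$ in $\mathcal B$, $\tilde u=0$ on $\partial\mathcal B$: the continuous function, affine on the triangles of $\mathcal T$ and zero on $\partial\mathcal B$, with $\int_{\mathcal B}\nabla\tilde v\cdot\nabla w\,dx=\int_{\mathcal B}(\Delta\tilde h)w\,dx$ for all $w$ in the same space. Let $g=\tilde v+\Pi(\tilde h)$, with $\Pi(\tilde h)$ the piecewise affine interpolant of $\tilde h$ at the vertices of $\mathcal T$. For a simple path $\gamma_\Lambda=[\omega_0,\dots,\omega_k=\omega]$ of Voronoi edges, disjoint from $\partial\mathcal B$ and joining vertices of Voronoi cells whose vertex boundary is disjoint from $\partial\mathcal B$, the flux fellow path is $\gamma_{\mathcal T}=[x_0,\dots,x_{k-1}]$,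 where $x_i$ is the endpoint to the right of $[\omega_i,\omega_{i+1}]$ of the unique edge of $\mathcal T$ intersecting it. For $y\in\gamma_{\mathcal T}$ let $\frac{\partial g}{\partial n}(\gamma_\Lambda,\gamma_{\mathcal T})(y)=\sum_{x\sim y}c(x,y)(g(x)-g(y))$, over all vertices $x$ adjacent to $y$ along an edge which intersects $\gamma_\Lambda$. The (multivalued) combinatorial conjugate is $\bar g^{*}(\omega)=\bar g^*(\omega_0)+\sum_{y\in\gamma_{\mathcal T}}\frac{\partial g}{\partial n}(\gamma_\Lambda,\gamma_{\mathcal T})(y)$, normalized by $\bar g^{*}(\omega_0)=0$ at base vertices converging to a fixed point of $\mathcal B$; $\mathrm{period}(\bar g^{*})$ is the same flux sum for a simple closed counterclockwise path of Voronoi edges of winding number 1 and its flux fellow path. The discrete map is $\omega\mapsto\exp\big(\frac{2\pi}{\mathrm{period}(\bar g^{*})}(g(\omega)+i\bar g^{*}(\omega))\big)$ at Voronoi vertices, extended affinely over the Voronoi cells (subdivided into triangles by diagonals from one vertex).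
   Formalization: For arbitrary local parameter and ξ0 (e.g. ξ0=2) the limit cannot be onto the unit disk minus 0; it is proved onto a punctured round disk for all data, and onto the punctured unit disk for suitable data, with f_n suitably chosen; the sign of the discrete flux is corrected. *)

theory Defs
  imports "HOL-Complex_Analysis.Complex_Analysis"
begin

section \<open>Plane domains\<close>

definition jordan_curve :: "complex set \<Rightarrow> bool" where
  "jordan_curve C \<longleftrightarrow>
     (\<exists>\<gamma>. simple_path \<gamma> \<and> pathfinish \<gamma> = pathstart \<gamma> \<and> path_image \<gamma> = C)"

definition polygonal_jordan_curve :: "complex set \<Rightarrow> bool" where
  "polygonal_jordan_curve C \<longleftrightarrow> jordan_curve C \<and>
     (\<exists>S. finite S \<and> C = (\<Union>(a, b)\<in>S. closed_segment a b))"

definition domain_bounded_by :: "complex set \<Rightarrow> complex set \<Rightarrow> bool" where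
  "domain_bounded_by D C \<longleftrightarrow>
     open D \<and> connected D \<and> D \<noteq> {} \<and> bounded D \<and> simply_connected D \<and> frontier D = C"

definition polygonal_annulus :: "complex set \<Rightarrow> complex set \<Rightarrow> bool" where
  "polygonal_annulus E1 E2 \<longleftrightarrow>
     polygonal_jordan_curve E1 \<and> polygonal_jordan_curve E2 \<and> E2 \<subseteq> inside E1"

text \<open>\<^term>\<open>outside E2\<close> is the complement of the closed disk bounded by \<^term>\<open>E2\<close>,
  so this is the open annulus with outer boundary \<^term>\<open>E1\<close> and inner boundary \<^term>\<open>E2\<close>.\<close>

definition annulus_of :: "complex set \<Rightarrow> complex set \<Rightarrow> complex set" where
  "annulus_of E1 E2 = inside E1 \<inter> outside E2"

definition round_annulus :: "complex \<Rightarrow> real \<Rightarrow> real \<Rightarrow> complex set" where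
  "round_annulus c r R = {w. r < cmod (w - c) \<and> cmod (w - c) < R}"

definition holomorphic_homeomorphism ::
    "(complex \<Rightarrow> complex) \<Rightarrow> complex set \<Rightarrow> complex set \<Rightarrow> bool" where
  "holomorphic_homeomorphism f S T \<longleftrightarrow> f holomorphic_on S \<and> (\<exists>g. homeomorphism S T f g)"

definition locally_uniform_limit ::
    "complex set \<Rightarrow> (nat \<Rightarrow> complex \<Rightarrow> complex) \<Rightarrow> (complex \<Rightarrow> complex) \<Rightarrow> bool" where
  "locally_uniform_limit S F f \<longleftrightarrow>
     (\<forall>K. compact K \<and> K \<subseteq> S \<longrightarrow> uniform_limit K F f sequentially)"


section \<open>Harmonic functions and the period of the conjugate\<close>

definition pdx :: "(complex \<Rightarrow> real) \<Rightarrow> complex \<Rightarrow> real" where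
  "pdx f z = frechet_derivative f (at z) 1"

definition pdy :: "(complex \<Rightarrow> real) \<Rightarrow> complex \<Rightarrow> real" where
  "pdy f z = frechet_derivative f (at z) \<i>"

definition gradient :: "(complex \<Rightarrow> real) \<Rightarrow> complex \<Rightarrow> complex" where
  "gradient f z = Complex (pdx f z) (pdy f z)"

definition C1_on :: "complex set \<Rightarrow> (complex \<Rightarrow> real) \<Rightarrow> bool" where
  "C1_on S f \<longleftrightarrow> (\<forall>z\<in>S. f differentiable (at z)) \<and>
     continuous_on S (pdx f) \<and> continuous_on S (pdy f)"

definition C2_on :: "complex set \<Rightarrow> (complex \<Rightarrow> real) \<Rightarrow> bool" where
  "C2_on S f \<longleftrightarrow> C1_on S f \<and> C1_on S (pdx f) \<and> C1_on S (pdy f)"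

definition laplacian :: "(complex \<Rightarrow> real) \<Rightarrow> complex \<Rightarrow> real" where
  "laplacian f z = pdx (pdx f) z + pdy (pdy f) z"

definition harmonic_on :: "complex set \<Rightarrow> (complex \<Rightarrow> real) \<Rightarrow> bool" where
  "harmonic_on S f \<longleftrightarrow> C2_on S f \<and> (\<forall>z\<in>S. laplacian f z = 0)"

text \<open>The unit normal to the right of the tangent is \<open>-\<i> \<beta>'/|\<beta>'|\<close>, and \<open>ds = |\<beta>'| dt\<close>.\<close>

definition normal_flux :: "(complex \<Rightarrow> real) \<Rightarrow> (real \<Rightarrow> complex) \<Rightarrow> real" where
  "normal_flux u \<beta> =
     integral {0..1} (\<lambda>t. gradient u (\<beta> t) \<bullet> (- \<i> * vector_derivative \<beta> (at t)))"

text \<open>The period of the harmonic conjugate of \<^term>\<open>u\<close> on the annulus \<^term>\<open>A\<close> whose bounded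
  complementary component is the closure of \<^term>\<open>D\<close>.\<close>

definition conjugate_period :: "complex set \<Rightarrow> complex set \<Rightarrow> (complex \<Rightarrow> real) \<Rightarrow> real" where
  "conjugate_period A D u = (THE p. \<forall>\<beta>.
     valid_path \<beta> \<and> simple_path \<beta> \<and> pathfinish \<beta> = pathstart \<beta> \<and> path_image \<beta> \<subseteq> A \<and>
     (\<forall>z\<in>D. winding_number \<beta> z = 1) \<longrightarrow> normal_flux u \<beta> = p)"


section \<open>Triangulations and Voronoi cells\<close>

text \<open>A triangulation is a set of closed triangles. The library predicate
  \<^const>\<open>triangulation\<close> contains finiteness and the condition that two members meet in a
  common face; for distinct triangles this is the empty set, a vertex or an edge.\<close>

definition triangulates :: "complex set set \<Rightarrow> complex set \<Rightarrow> bool" where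
  "triangulates T B \<longleftrightarrow> triangulation T \<and> (\<forall>t\<in>T. 2 simplex t) \<and> \<Union>T = closure B"

definition vertices :: "complex set set \<Rightarrow> complex set" where
  "vertices T = {x. \<exists>t\<in>T. x extreme_point_of t}"

definition adjacent :: "complex set set \<Rightarrow> complex \<Rightarrow> complex \<Rightarrow> bool" where
  "adjacent T x y \<longleftrightarrow> x \<noteq> y \<and> (\<exists>t\<in>T. x extreme_point_of t \<and> y extreme_point_of t)"

definition mesh_size :: "complex set set \<Rightarrow> real" where
  "mesh_size T = Max (diameter ` T)"

definition inscribed_diameter :: "complex set \<Rightarrow> real" where
  "inscribed_diameter t = Sup {2 * r | r c. 0 \<le> r \<and> cball c r \<subseteq> t}"

definition quasi_uniform :: "(nat \<Rightarrow> complex set set) \<Rightarrow> bool" where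
  "quasi_uniform T \<longleftrightarrow> (\<exists>\<tau> \<delta>. \<delta> > 0 \<and>
     (\<forall>m. mesh_size (T m) < \<delta> \<longrightarrow> (\<forall>t\<in>T m. diameter t / inscribed_diameter t \<le> \<tau>)))"

definition nonobtuse :: "complex set \<Rightarrow> bool" where
  "nonobtuse t \<longleftrightarrow> (\<forall>x y z. x extreme_point_of t \<and> y extreme_point_of t \<and> z extreme_point_of t
     \<longrightarrow> (y - x) \<bullet> (z - x) \<ge> 0)"

definition circumcenter :: "complex set \<Rightarrow> complex" where
  "circumcenter t =
     (THE c. \<forall>x y. x extreme_point_of t \<and> y extreme_point_of t \<longrightarrow> dist c x = dist c y)"

text \<open>The common side of the Voronoi cells of \<^term>\<open>x\<close> and \<^term>\<open>y\<close>: the segment joining the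
  circumcenters of the two triangles sharing the edge \<open>[x,y]\<close>. It is a single point if the
  circumcenters coincide (two right triangles with a common hypotenuse), and it is empty for
  an edge on the boundary, which belongs to only one triangle.\<close>

definition voronoi_side :: "complex set set \<Rightarrow> complex \<Rightarrow> complex \<Rightarrow> complex set" where
  "voronoi_side T x y = \<Union>{closed_segment (circumcenter s) (circumcenter t) | s t.
     s \<in> T \<and> t \<in> T \<and> s \<noteq> t \<and>
     x extreme_point_of s \<and> y extreme_point_of s \<and> x extreme_point_of t \<and> y extreme_point_of t}"

text \<open>The diameter of a segment is its length.\<close>

definition conductance :: "complex set set \<Rightarrow> complex \<Rightarrow> complex \<Rightarrow> real" where
  "conductance T x y = diameter (voronoi_side T x y) / dist x y"

definition midpoint_condition :: "complex set set \<Rightarrow> bool" where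
  "midpoint_condition T \<longleftrightarrow> (\<forall>x y a b.
     adjacent T x y \<and> voronoi_side T x y = closed_segment a b \<longrightarrow>
     closed_segment x y \<inter> voronoi_side T x y = {midpoint a b})"

definition admissible_triangulations ::
    "complex set \<Rightarrow> complex set \<Rightarrow> (nat \<Rightarrow> complex set set) \<Rightarrow> bool" where
  "admissible_triangulations E1 E2 T \<longleftrightarrow>
     (\<forall>m. triangulates (T m) (annulus_of E1 E2)) \<and>
     quasi_uniform T \<and>
     (\<lambda>m. mesh_size (T m)) \<longlonglongrightarrow> 0 \<and>
     (\<forall>m. \<forall>t\<in>T m. nonobtuse t) \<and>
     (\<exists>N::nat. \<forall>\<^sub>F m in sequentially. \<forall>x\<in>vertices (T m). card {y. adjacent (T m) x y} \<le> N) \<and>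
     (\<forall>\<^sub>F m in sequentially. midpoint_condition (T m))"


section \<open>The discrete potential\<close>

definition boundary_extension ::
    "complex set \<Rightarrow> complex set \<Rightarrow> (complex \<Rightarrow> real) \<Rightarrow> bool" where
  "boundary_extension E1 E2 h \<longleftrightarrow>
     C2_on (annulus_of E1 E2) h \<and> continuous_on (closure (annulus_of E1 E2)) h \<and>
     (\<forall>z\<in>E1. h z = 1) \<and> (\<forall>z\<in>E2. h z = 0) \<and>
     set_integrable lebesgue (annulus_of E1 E2) (\<lambda>z. (laplacian h z)\<^sup>2) \<and>
     \<not> (AE z in lebesgue. z \<in> annulus_of E1 E2 \<longrightarrow> laplacian h z = 0)"

definition piecewise_affine :: "complex set set \<Rightarrow> (complex \<Rightarrow> real) \<Rightarrow> bool" where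
  "piecewise_affine T w \<longleftrightarrow> continuous_on (\<Union>T) w \<and>
     (\<forall>t\<in>T. \<exists>(a::real) (b::complex). \<forall>z\<in>t. w z = a + b \<bullet> z)"

definition fe_space ::
    "complex set \<Rightarrow> complex set \<Rightarrow> complex set set \<Rightarrow> (complex \<Rightarrow> real) set" where
  "fe_space E1 E2 T = {w. piecewise_affine T w \<and> (\<forall>z\<in>E1 \<union> E2. w z = 0)}"

text \<open>The gradients below exist off the edges of the triangulation, hence almost everywhere;
  Lebesgue (rather than Borel) measure makes the values on the edges irrelevant also for
  measurability.\<close>

definition fe_approximation ::
    "complex set \<Rightarrow> complex set \<Rightarrow> complex set set \<Rightarrow> (complex \<Rightarrow> real) \<Rightarrow> (complex \<Rightarrow> real) \<Rightarrow> bool"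
  where
  "fe_approximation E1 E2 T h v \<longleftrightarrow> v \<in> fe_space E1 E2 T \<and>
     (\<forall>w\<in>fe_space E1 E2 T.
        (LINT z:annulus_of E1 E2|lebesgue. gradient v z \<bullet> gradient w z) =
        (LINT z:annulus_of E1 E2|lebesgue. laplacian h z * w z))"

definition discrete_potential ::
    "complex set \<Rightarrow> complex set \<Rightarrow> complex set set \<Rightarrow> (complex \<Rightarrow> real) \<Rightarrow> (complex \<Rightarrow> real) \<Rightarrow> bool"
  where
  "discrete_potential E1 E2 T h g \<longleftrightarrow> (\<exists>v p.
     fe_approximation E1 E2 T h v \<and>
     piecewise_affine T p \<and> (\<forall>x\<in>vertices T. p x = h x) \<and>
     (\<forall>z\<in>\<Union>T. g z = v z + p z))"


section \<open>The combinatorial conjugate and the discrete maps\<close>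

fun polyline :: "complex list \<Rightarrow> real \<Rightarrow> complex" where
  "polyline [] = linepath 0 0"
| "polyline [a] = linepath a a"
| "polyline [a, b] = linepath a b"
| "polyline (a # b # c # l) = linepath a b +++ polyline (b # c # l)"

definition voronoi_path :: "complex set \<Rightarrow> complex set \<Rightarrow> complex set set \<Rightarrow> complex list \<Rightarrow> bool" where
  "voronoi_path E1 E2 T l \<longleftrightarrow> l \<noteq> [] \<and>
     (\<forall>i. Suc i < length l \<longrightarrow>
        (\<exists>x y. adjacent T x y \<and> voronoi_side T x y = closed_segment (l ! i) (l ! Suc i))) \<and>
     path_image (polyline l) \<inter> (E1 \<union> E2) = {}"

definition cell_vertices :: "complex set set \<Rightarrow> complex \<Rightarrow> complex set" where
  "cell_vertices T x = {circumcenter t | t. t \<in> T \<and> x extreme_point_of t}"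

text \<open>Circumcenters form a closed polygon only around vertices off the boundary; the vertices of
  such a cell may still lie on the boundary (a right triangle with hypotenuse on it), which is
  excluded.\<close>

definition inner_cells :: "complex set \<Rightarrow> complex set \<Rightarrow> complex set set \<Rightarrow> complex set" where
  "inner_cells E1 E2 T =
     {x \<in> vertices T. x \<notin> E1 \<union> E2 \<and> cell_vertices T x \<inter> (E1 \<union> E2) = {}}"

definition voronoi_vertices :: "complex set \<Rightarrow> complex set \<Rightarrow> complex set set \<Rightarrow> complex set" where
  "voronoi_vertices E1 E2 T = (\<Union>x\<in>inner_cells E1 E2 T. cell_vertices T x)"

definition simple_voronoi_path ::
    "complex set \<Rightarrow> complex set \<Rightarrow> complex set set \<Rightarrow> complex \<Rightarrow> complex \<Rightarrow> complex list \<Rightarrow> bool" where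
  "simple_voronoi_path E1 E2 T a b l \<longleftrightarrow>
     voronoi_path E1 E2 T l \<and> hd l = a \<and> last l = b \<and> (length l = 1 \<or> arc (polyline l))"

definition voronoi_loop :: "complex set \<Rightarrow> complex set \<Rightarrow> complex set set \<Rightarrow> complex list \<Rightarrow> bool" where
  "voronoi_loop E1 E2 T l \<longleftrightarrow>
     voronoi_path E1 E2 T l \<and> simple_path (polyline l) \<and> hd l = last l \<and>
     path_image (polyline l) \<subseteq> annulus_of E1 E2 \<and>
     (\<forall>z\<in>inside E2. winding_number (polyline l) z = 1)"

definition right_of :: "complex \<Rightarrow> complex \<Rightarrow> complex \<Rightarrow> bool" where
  "right_of a b y \<longleftrightarrow> Im (cnj (b - a) * (y - a)) < 0"

text \<open>The set of vertices of the flux fellow path. The edge crossed by a Voronoi edge is the one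
  dual to it: for right triangles the endpoints of a Voronoi edge may also lie on hypotenuses.\<close>

definition fellow_vertices :: "complex set set \<Rightarrow> complex list \<Rightarrow> complex set" where
  "fellow_vertices T l = {y. \<exists>i x. Suc i < length l \<and> adjacent T x y \<and>
     voronoi_side T x y = closed_segment (l ! i) (l ! Suc i) \<and> right_of (l ! i) (l ! Suc i) y}"

text \<open>Here \<^term>\<open>y\<close> lies to the right of the path and \<^term>\<open>x\<close> to the left. The differences
  are oriented as \<open>g y - g x\<close>, so that the flux is taken along the normal pointing to the right,
  as in \<^const>\<open>normal_flux\<close>. With the opposite sign, the conjugate and its period would
  approximate the negatives of their continuous counterparts, and the discrete maps would
  approximate the anti-holomorphic map \<open>1 / cnj \<Phi>\<close> in place of \<open>\<Phi>\<close>.\<close>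

definition discrete_flux :: "complex set set \<Rightarrow> (complex \<Rightarrow> real) \<Rightarrow> complex list \<Rightarrow> real" where
  "discrete_flux T g l = (\<Sum>y\<in>fellow_vertices T l.
     \<Sum>x | adjacent T x y \<and> closed_segment x y \<inter> path_image (polyline l) \<noteq> {}.
       conductance T x y * (g y - g x))"

definition affine_on :: "complex set \<Rightarrow> (complex \<Rightarrow> complex) \<Rightarrow> bool" where
  "affine_on S F \<longleftrightarrow> (\<exists>c d e. \<forall>z\<in>S. F z = c + of_real (Re z) * d + of_real (Im z) * e)"

text \<open>The conjugate is multivalued (and \<^term>\<open>g\<close> is only approximately discrete harmonic, so
  that fluxes may depend on the path), whence this is a relation: a discrete map comes with a
  choice of a loop for the period and of a path from the base vertex to each Voronoi vertex.
  On each cell it is the affine extension after subdivision by the diagonals from one cell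
  vertex \<open>o\<close>, i.e.\ into the triangles with apex \<open>o\<close> over the sides \<open>[a,b]\<close> of the cell.\<close>

definition discrete_map ::
    "complex set \<Rightarrow> complex set \<Rightarrow> complex set set \<Rightarrow> (complex \<Rightarrow> real) \<Rightarrow> complex \<Rightarrow>
     (complex \<Rightarrow> complex) \<Rightarrow> bool" where
  "discrete_map E1 E2 T h \<omega>0 F \<longleftrightarrow> (\<exists>g loop pth.
     discrete_potential E1 E2 T h g \<and>
     voronoi_loop E1 E2 T loop \<and>
     \<omega>0 \<in> voronoi_vertices E1 E2 T \<and>
     (\<forall>\<omega>\<in>voronoi_vertices E1 E2 T.
        simple_voronoi_path E1 E2 T \<omega>0 \<omega> (pth \<omega>) \<and>
        F \<omega> = exp (of_real (2 * pi / discrete_flux T g loop) *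
                   (of_real (g \<omega>) + \<i> * of_real (discrete_flux T g (pth \<omega>))))) \<and>
     (\<forall>x\<in>inner_cells E1 E2 T. \<exists>v\<in>cell_vertices T x. \<forall>y a b.
        adjacent T x y \<and> voronoi_side T x y = closed_segment a b \<longrightarrow>
        affine_on (convex hull {v, a, b}) F))"

definition limit_of_discrete_maps ::
    "complex set \<Rightarrow> complex set \<Rightarrow> (nat \<Rightarrow> complex set set) \<Rightarrow> (complex \<Rightarrow> complex) \<Rightarrow> bool" where
  "limit_of_discrete_maps E1 E2 T \<phi> \<longleftrightarrow> (\<exists>h \<omega>0 a F.
     boundary_extension E1 E2 h \<and>
     a \<in> annulus_of E1 E2 \<and> \<omega>0 \<longlonglongrightarrow> a \<and>
     (\<forall>\<^sub>F m in sequentially. discrete_map E1 E2 (T m) h (\<omega>0 m) (F m)) \<and>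
     locally_uniform_limit (annulus_of E1 E2) F \<phi>)"


section \<open>Normalization\<close>

definition inversion :: "complex \<Rightarrow> complex" where
  "inversion z = 1 / z"

definition local_parameter :: "complex \<Rightarrow> (complex \<Rightarrow> complex) \<Rightarrow> bool" where
  "local_parameter z0 \<zeta> \<longleftrightarrow> \<zeta> z0 = 0 \<and>
     (\<exists>U. open U \<and> z0 \<in> U \<and> \<zeta> holomorphic_on U \<and> inj_on \<zeta> U)"

text \<open>By the chain rule, \<open>deriv G z0 / deriv \<zeta> z0\<close> is the derivative at \<open>z0\<close> of \<open>G\<close> with respect
  to the local parameter \<open>\<zeta>\<close>.\<close>

definition normalizing_map ::
    "complex set \<Rightarrow> (complex \<Rightarrow> complex) \<Rightarrow> complex \<Rightarrow> (complex \<Rightarrow> complex) \<Rightarrow> complex \<Rightarrow>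
     (complex \<Rightarrow> complex) \<Rightarrow> bool" where
  "normalizing_map E \<Phi> z0 \<zeta> \<xi>0 f \<longleftrightarrow>
     f holomorphic_on (inversion ` E) \<and> inj_on f (inversion ` E) \<and>
     (\<exists>c r R. 0 < r \<and> r < R \<and> f ` inversion ` E = round_annulus c r R) \<and>
     (f \<circ> inversion \<circ> \<Phi>) z0 = \<xi>0 \<and>
     deriv (f \<circ> inversion \<circ> \<Phi>) z0 / deriv \<zeta> z0 = 1"

definition normalized_subsequence_limit ::
    "complex set \<Rightarrow> (nat \<Rightarrow> complex set) \<Rightarrow> (nat \<Rightarrow> complex \<Rightarrow> complex) \<Rightarrow>
     complex \<Rightarrow> (complex \<Rightarrow> complex) \<Rightarrow> complex \<Rightarrow> (complex \<Rightarrow> complex) \<Rightarrow> bool" where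
  "normalized_subsequence_limit S E \<Phi> z0 \<zeta> \<xi>0 \<Psi> \<longleftrightarrow> (\<exists>f s.
     (\<forall>n. normalizing_map (E n) (\<Phi> n) z0 \<zeta> \<xi>0 (f n)) \<and>
     strict_mono (s :: nat \<Rightarrow> nat) \<and>
     locally_uniform_limit S (\<lambda>k. f (s k) \<circ> inversion \<circ> \<Phi> (s k)) \<Psi>)"

end

theory Submission
  imports Defs "HOL-Library.Diagonal_Subsequence"
begin

text \<open>
  Let \<open>f\<close> be a Riemann map of \<open>\<Omega>\<close> with \<open>f p0 = 0\<close>. Transported by \<open>f\<close>, the map \<open>\<sigma> \<circ> \<Phi>\<^sub>n\<close> becomes
  a conformal map \<open>H\<^sub>n\<close> of the unit disk minus a compact set \<open>K\<^sub>n\<close> containing \<open>0\<close> and shrinking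
  to \<open>0\<close>, onto \<open>{1/R\<^sub>n < |w| < 1}\<close>; after composing with \<open>w \<mapsto> 1/(R\<^sub>n w)\<close> if necessary, the unit circle
  corresponds to the unit circle. Since \<open>H\<^sub>n\<close> of any circle around \<open>K\<^sub>n\<close> meets every ray from \<open>0\<close>,
  a subsequential limit \<open>G\<close> of the bounded maps \<open>H\<^sub>n\<close>, extended over \<open>0\<close>, satisfies \<open>G 0 = 0\<close>, and so
  \<open>|G z| \<le> |z|\<close> by the Schwarz lemma; in particular \<open>R\<^sub>n\<close> tends to infinity. The same argument
  applies to the inverse maps, and the two inequalities force \<open>G\<close> to be a rotation.
  The normalization cancels the rotation, so that the normalized limit is
  \<open>\<xi>0 + \<zeta>'(z0)/f'(z0) (f - f(z0))\<close>.
\<close>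

section \<open>Conformal maps between perforated disks\<close>

text \<open>The last two conditions say that \<open>H\<close> and \<open>L\<close> carry the end at
  the unit circle to the end at the unit circle, with no boundary values assumed. Holomorphy is left
  out and the second perforation \<open>K'\<close> is arbitrary, so that the notion is symmetric and
  every consequence also holds for the inverse map.\<close>

definition perforated_disc_iso ::
    "complex set \<Rightarrow> complex set \<Rightarrow> (complex \<Rightarrow> complex) \<Rightarrow> (complex \<Rightarrow> complex) \<Rightarrow> bool" where
  "perforated_disc_iso K K' H L \<longleftrightarrow>
     compact K \<and> 0 \<in> K \<and> K \<subseteq> ball 0 1 \<and> compact K' \<and> 0 \<in> K' \<and> K' \<subseteq> ball 0 1 \<and>
     homeomorphism (ball 0 1 - K) (ball 0 1 - K') H L \<and>
     (\<forall>t<1. \<exists>\<rho><1. \<forall>z\<in>ball 0 1 - K. \<rho> < norm z \<longrightarrow> t < norm (H z)) \<and>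
     (\<forall>t<1. \<exists>\<rho><1. \<forall>w\<in>ball 0 1 - K'. \<rho> < norm w \<longrightarrow> t < norm (L w))"

lemma perforated_disc_iso_sym:
  "perforated_disc_iso K K' H L \<Longrightarrow> perforated_disc_iso K' K L H"
  by (auto simp: perforated_disc_iso_def intro: homeomorphism_symD)

lemma perforated_disc_iso_inverse:
  assumes "perforated_disc_iso K K' H L"
  shows "z \<in> ball 0 1 - K \<Longrightarrow> H z \<in> ball 0 1 - K' \<and> L (H z) = z"
    and "w \<in> ball 0 1 - K' \<Longrightarrow> L w \<in> ball 0 1 - K \<and> H (L w) = w"
proof -
  have h: "homeomorphism (ball 0 1 - K) (ball 0 1 - K') H L"
    using assms by (simp add: perforated_disc_iso_def)
  show "z \<in> ball 0 1 - K \<Longrightarrow> H z \<in> ball 0 1 - K' \<and> L (H z) = z"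
    using h unfolding homeomorphism_def by blast
  show "w \<in> ball 0 1 - K' \<Longrightarrow> L w \<in> ball 0 1 - K \<and> H (L w) = w"
    using h unfolding homeomorphism_def by blast
qed

section \<open>Circles around the perforation and the value of a limit at 0\<close>

lemma connected_norm_ivt:
  fixes S :: "'a::real_normed_vector set"
  assumes "connected S" "a \<in> S" "b \<in> S" "norm a \<le> s" "s \<le> norm b"
  shows "\<exists>z\<in>S. norm z = s"
proof -
  have "connected (norm ` S)"
    by (intro connected_continuous_image assms continuous_intros)
  then have "s \<in> norm ` S"
    using connectedD_interval assms by (metis imageI)
  then show ?thesis by auto
qed

text \<open>The preimage of a radial segment runs from the inner to the outer end, so it crosses the
  circle.\<close>

lemma perforated_disc_iso_circle_meets_ray:
  assumes iso: "perforated_disc_iso K K' H L"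
    and K: "K \<subseteq> ball 0 s" and s: "s < 1" and e: "norm e = 1"
  shows "\<exists>z c. norm z = s \<and> 0 < c \<and> H z = of_real c * e"
proof -
  have cK': "compact K'" and 0: "0 \<in> K'" and K'1: "K' \<subseteq> ball 0 1"
    and hom: "homeomorphism (ball 0 1 - K) (ball 0 1 - K') H L"
    and outH: "\<And>t. t < 1 \<Longrightarrow> \<exists>\<rho><1. \<forall>z\<in>ball 0 1 - K. \<rho> < norm z \<longrightarrow> t < norm (H z)"
    and outL: "\<And>t. t < 1 \<Longrightarrow> \<exists>\<rho><1. \<forall>w\<in>ball 0 1 - K'. \<rho> < norm w \<longrightarrow> t < norm (L w)"
    using iso unfolding perforated_disc_iso_def by auto
  note inv = perforated_disc_iso_inverse[OF iso]
  \<comment> \<open>The maximum \<open>\<tau>0\<close> of \<open>J\<close> is the last time the ray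
    meets \<open>K'\<close>; it exists because 0 lies in \<open>K'\<close>. From there to the unit
    circle the ray runs in the domain of \<open>L\<close>.\<close>
  define J where "J = {\<tau>. 0 \<le> \<tau> \<and> of_real \<tau> * e \<in> K'}"
  have "J = {0..1} \<inter> (\<lambda>\<tau>. of_real \<tau> * e) -` K'"
    using K'1 e by (auto simp: J_def norm_mult subset_iff less_imp_le)
  moreover have "closed ((\<lambda>\<tau>. of_real \<tau> * e) -` K')"
    by (intro closed_vimage compact_imp_closed cK' continuous_intros)
  ultimately have "compact J"
    by (simp add: compact_Int_closed)
  moreover have "J \<noteq> {}" using 0 by (auto simp: J_def intro!: exI[of _ 0])
  ultimately obtain \<tau>0 where \<tau>0: "\<tau>0 \<in> J" "\<And>\<tau>. \<tau> \<in> J \<Longrightarrow> \<tau> \<le> \<tau>0"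
    by (meson compact_attains_sup)
  have \<tau>0_lt: "\<tau>0 < 1" "0 \<le> \<tau>0"
    using \<tau>0 K'1 e by (auto simp: J_def norm_mult subset_iff)
  define Z where "Z = (\<lambda>\<tau>. of_real \<tau> * e) ` {\<tau>0<..<1}"
  have Zsub: "Z \<subseteq> ball 0 1 - K'"
  proof
    fix w assume "w \<in> Z"
    then obtain \<tau> where w: "w = of_real \<tau> * e" and \<tau>: "\<tau> \<in> {\<tau>0<..<1}"
      unfolding Z_def by (rule imageE)
    have "\<tau> \<notin> J" using \<tau>0(2)[of \<tau>] \<tau> by auto
    then show "w \<in> ball 0 1 - K'" using w \<tau> \<tau>0_lt e by (simp add: J_def norm_mult)
  qed
  have "connected Z" unfolding Z_def
    by (intro connected_continuous_image continuous_intros) auto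
  then have conn: "connected (L ` Z)"
    using hom Zsub by (meson connected_continuous_image continuous_on_subset homeomorphism_def)
  have "\<exists>w\<in>Z. s \<le> norm (L w)"
  proof -
    obtain \<rho> where \<rho>: "\<rho> < 1" "\<forall>w\<in>ball 0 1 - K'. \<rho> < norm w \<longrightarrow> s < norm (L w)"
      using outL[OF s] by blast
    define \<tau> where "\<tau> = (max \<rho> \<tau>0 + 1) / 2"
    have "\<tau>0 < \<tau>" "\<tau> < 1" "\<rho> < \<tau>" using \<rho> \<tau>0_lt by (auto simp: \<tau>_def max_def field_simps)
    moreover then have "of_real \<tau> * e \<in> Z" by (auto simp: Z_def)
    moreover have "norm (of_real \<tau> * e) = \<tau>" using \<open>\<tau>0 < \<tau>\<close> \<tau>0_lt e by (simp add: norm_mult)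
    ultimately show ?thesis using \<rho>(2) Zsub by (metis less_imp_le subsetD)
  qed
  moreover have "\<exists>w\<in>Z. norm (L w) \<le> s"
  proof -
    define t where "t = (\<tau>0 + 1) / 2"
    have t: "\<tau>0 < t" "t < 1" using \<tau>0_lt by (auto simp: t_def)
    obtain \<rho> where \<rho>: "\<rho> < 1" "\<forall>z\<in>ball 0 1 - K. \<rho> < norm z \<longrightarrow> t < norm (H z)"
      using outH[OF t(2)] by blast
    define C where "C = {z::complex. s \<le> norm z \<and> norm z \<le> \<rho>}"
    have "C = cball 0 \<rho> - ball 0 s" by (auto simp: C_def)
    then have "compact C" by (simp add: compact_diff)
    have Csub: "C \<subseteq> ball 0 1 - K" using K \<rho>(1) by (auto simp: C_def subset_iff)
    have "compact (H ` C)"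
      using \<open>compact C\<close> Csub hom
      by (meson compact_continuous_image continuous_on_subset homeomorphism_def)
    then have "open (- (H ` C))" by (simp add: compact_imp_closed open_Compl)
    moreover have "of_real \<tau>0 * e \<in> - (H ` C)"
      using \<tau>0(1) inv(1) Csub by (auto simp: J_def)
    ultimately obtain d where d: "d > 0" "ball (of_real \<tau>0 * e) d \<subseteq> - (H ` C)"
      using open_contains_ball by blast
    define \<tau> where "\<tau> = \<tau>0 + min (d/2) ((t - \<tau>0)/2)"
    have \<tau>: "\<tau>0 < \<tau>" "\<tau> < t" "\<tau> - \<tau>0 < d" using d t by (auto simp: \<tau>_def min_def field_simps)
    define w where "w = of_real \<tau> * e"
    have "w \<in> Z" using \<tau> t by (auto simp: w_def Z_def)
    have nw: "norm w = \<tau>" using \<tau> \<tau>0_lt e by (simp add: w_def norm_mult)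
    have "dist (of_real \<tau>0 * e) w = norm (of_real (\<tau>0 - \<tau>) * e)"
      by (simp add: w_def dist_norm algebra_simps)
    also have "\<dots> < d" using \<tau> e by (simp only: norm_mult norm_of_real)  simp
    finally have "w \<notin> H ` C" using d by auto
    have Lw: "L w \<in> ball 0 1 - K" "H (L w) = w" using inv(2) \<open>w \<in> Z\<close> Zsub by blast+
    then have "L w \<notin> C" using \<open>w \<notin> H ` C\<close> by (metis imageI)
    moreover have "\<not> \<rho> < norm (L w)" using \<rho>(2) Lw nw \<tau> by force
    ultimately have "norm (L w) \<le> s" by (auto simp: C_def)
    then show ?thesis using \<open>w \<in> Z\<close> by blast
  qed
  ultimately obtain z where z: "z \<in> L ` Z" "norm z = s"
    using connected_norm_ivt[OF conn] by blast
  then obtain w where "w \<in> Z" "z = L w" by blast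
  then have "H z = w" using inv(2) Zsub by blast
  moreover obtain \<tau> where "w = of_real \<tau> * e" "\<tau> \<in> {\<tau>0<..<1}"
    using \<open>w \<in> Z\<close> unfolding Z_def by (rule imageE)
  ultimately show ?thesis using \<open>z = L w\<close> z(2) \<tau>0_lt by (intro exI[of _ z] exI[of _ \<tau>]) auto
qed

text \<open>If \<open>G 0\<close> were nonzero, a small circle would have its image under
  \<open>H n\<close> concentrated near \<open>G 0\<close>. But once it surrounds \<open>K n\<close>,
  that image meets every ray from 0, also the one pointing away from \<open>G 0\<close>.\<close>

lemma perforated_disc_iso_limit_at_0:
  fixes \<epsilon> :: "nat \<Rightarrow> real"
  assumes iso: "\<And>n. perforated_disc_iso (K n) (K' n) (H n) (L n)"
    and K: "\<And>n. K n \<subseteq> ball 0 (\<epsilon> n)" and \<epsilon>: "\<epsilon> \<longlonglongrightarrow> 0"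
    and G: "isCont G 0"
    and lim: "\<And>C. compact C \<Longrightarrow> C \<subseteq> ball 0 1 - {0} \<Longrightarrow> uniform_limit C H G sequentially"
  shows "G 0 = 0"
proof (rule ccontr)
  assume h: "G 0 \<noteq> 0"
  then obtain d where d: "d > 0" "\<And>z. dist z 0 < d \<Longrightarrow> dist (G z) (G 0) < norm (G 0) / 2"
    using G unfolding continuous_at_eps_delta by (metis half_gt_zero zero_less_norm_iff)
  define s where "s = min (d/2) (1/2)"
  have s: "0 < s" "s < 1" "s < d" using d by (auto simp: s_def)
  have "uniform_limit (sphere 0 s) H G sequentially"
    using s by (intro lim) auto
  then have "\<forall>\<^sub>F n in sequentially. \<forall>z\<in>sphere 0 s. dist (H n z) (G z) < norm (G 0) / 2"
    using h by (intro uniform_limitD) auto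
  moreover have "\<forall>\<^sub>F n in sequentially. \<epsilon> n < s"
    using \<epsilon> s by (intro order_tendstoD) auto
  ultimately have "\<forall>\<^sub>F n in sequentially. False"
  proof eventually_elim
    case (elim n)
    \<comment> \<open>Every point of the ray opposite to \<open>G 0\<close> is at distance at least
      \<open>norm (G 0)\<close> from \<open>G 0\<close>, while the two half estimates add up to a
      strictly smaller distance.\<close>
    define e where "e = - G 0 / of_real (norm (G 0))"
    have "norm e = 1" using h by (simp add: e_def norm_divide)
    moreover have "K n \<subseteq> ball 0 s" using K[of n] elim by force
    ultimately obtain z c where z: "norm z = s" "0 < c" "H n z = of_real c * e"
      using perforated_disc_iso_circle_meets_ray[OF iso] s by blast
    have "z \<in> sphere 0 s" using z by simp
    then have "dist (H n z) (G z) < norm (G 0) / 2" using elim(1) by blast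
    moreover have "dist (G z) (G 0) < norm (G 0) / 2" using z s by (intro d(2)) simp
    ultimately have "dist (H n z) (G 0) < norm (G 0)"
      using dist_triangle[of "H n z" "G 0" "G z"] by linarith
    moreover have "H n z - G 0 = of_real (- (c / norm (G 0)) - 1) * G 0"
      using z h by (simp add: e_def field_simps)
    then have "dist (H n z) (G 0) = \<bar>- (c / norm (G 0)) - 1\<bar> * norm (G 0)"
      by (simp only: dist_norm norm_mult norm_of_real)
    moreover have "\<bar>- (c / norm (G 0)) - 1\<bar> \<ge> 1" using z h by (simp add: field_simps)
    ultimately show False using h by (simp add: mult_less_cancel_right2)
  qed
  then show False by simp
qed

section \<open>Normal families on an exhaustion\<close>

text \<open>The functions may have different domains: each \<open>S j\<close> has to be contained in
  the domain only for large \<open>n\<close>. Montel's theorem is therefore applied on each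
  \<open>S j\<close> to a tail of the sequence, and a diagonal subsequence serves all
  \<open>j\<close> at once.\<close>

lemma Montel_exhaustion:
  fixes F :: "nat \<Rightarrow> complex \<Rightarrow> complex" and S :: "nat \<Rightarrow> complex set"
  assumes opn: "\<And>j. open (S j)" and mono: "\<And>i j. i \<le> j \<Longrightarrow> S i \<subseteq> S j"
    and F: "\<And>j. \<forall>\<^sub>F n in sequentially. F n holomorphic_on S j \<and> (\<forall>z\<in>S j. norm (F n z) \<le> B)"
  obtains r g where "strict_mono (r :: nat \<Rightarrow> nat)" "g holomorphic_on (\<Union>j. S j)"
    "\<And>C. compact C \<Longrightarrow> C \<subseteq> (\<Union>j. S j) \<Longrightarrow> uniform_limit C (F \<circ> r) g sequentially"
proof -
  define P where "P = (\<lambda>j s. \<exists>g. g holomorphic_on S j \<and>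
    (\<forall>C. compact C \<and> C \<subseteq> S j \<longrightarrow> uniform_limit C (F \<circ> s) g sequentially))"
  interpret subseqs P
  proof
    fix j and s :: "nat \<Rightarrow> nat" assume s: "strict_mono s"
    obtain N where N: "\<And>n. n \<ge> N \<Longrightarrow> F n holomorphic_on S j \<and> (\<forall>z\<in>S j. norm (F n z) \<le> B)"
      using F[of j] unfolding eventually_sequentially by blast
    \<comment> \<open>A strictly increasing \<open>s\<close> satisfies
      \<open>s (n + N) \<ge> n + N\<close>, so this shift discards all functions that are not yet
      holomorphic and bounded on \<open>S j\<close>.\<close>
    define F' where "F' = (\<lambda>n. F (s (n + N)))"
    have F': "F' n holomorphic_on S j \<and> (\<forall>z\<in>S j. norm (F' n z) \<le> B)" for n
      unfolding F'_def using seq_suble[OF s, of "n + N"] by (intro N) simp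
    obtain g r where gr: "g holomorphic_on S j" "strict_mono (r :: nat \<Rightarrow> nat)"
        "\<And>C. compact C \<Longrightarrow> C \<subseteq> S j \<Longrightarrow> uniform_limit C (F' \<circ> r) g sequentially"
    proof (rule Montel[of "S j" "range F'" F'])
      fix C assume "C \<subseteq> S j"
      then show "\<exists>B. \<forall>h\<in>range F'. \<forall>z\<in>C. norm (h z) \<le> B" using F' by blast
    qed (use opn F' in auto)
    define r' where "r' = (\<lambda>n. r n + N)"
    have "F \<circ> (s \<circ> r') = F' \<circ> r" by (auto simp: r'_def F'_def o_def)
    moreover have "strict_mono r'" using gr(2) by (auto simp: r'_def strict_mono_def)
    ultimately show "\<exists>r'. strict_mono r' \<and> P j (s \<circ> r')"
      unfolding P_def using gr(1,3) by metis
  qed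
  have "P k (diagseq \<circ> (+) (Suc k))" for k
  proof (rule diagseq_holds)
    fix r s :: "nat \<Rightarrow> nat" and n assume r: "strict_mono r" and "P n s"
    then obtain g where g: "g holomorphic_on S n"
        "\<And>C. compact C \<and> C \<subseteq> S n \<Longrightarrow> uniform_limit C (F \<circ> s) g sequentially"
      unfolding P_def by blast
    have "uniform_limit C (F \<circ> (s \<circ> r)) g sequentially" if "compact C \<and> C \<subseteq> S n" for C
      using g(2)[OF that] eventually_subseq[OF r] unfolding uniform_limit_iff by fastforce
    then show "P n (s \<circ> r)" unfolding P_def using g(1) by blast
  qed
  then have "\<exists>g. g holomorphic_on S k \<and>
      (\<forall>C. compact C \<and> C \<subseteq> S k \<longrightarrow> uniform_limit C (F \<circ> diagseq) g sequentially)" for k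
  proof -
    assume "P k (diagseq \<circ> (+) (Suc k))" for k
    then obtain g where g: "g holomorphic_on S k" "\<And>C. compact C \<and> C \<subseteq> S k \<Longrightarrow>
        uniform_limit C (F \<circ> (diagseq \<circ> (+) (Suc k))) g sequentially"
      unfolding P_def by blast
    have "uniform_limit C (F \<circ> diagseq) g sequentially" if "compact C \<and> C \<subseteq> S k" for C
      unfolding uniform_limit_iff
    proof (intro allI impI)
      fix e :: real assume "e > 0"
      then have "\<forall>\<^sub>F n in sequentially. \<forall>x\<in>C. dist ((F \<circ> diagseq) (n + Suc k) x) (g x) < e"
        using g(2)[OF that] unfolding uniform_limit_iff by (simp add: o_def add.commute)
      then show "\<forall>\<^sub>F n in sequentially. \<forall>x\<in>C. dist ((F \<circ> diagseq) n x) (g x) < e"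
        by (rule eventually_sequentially_seg[THEN iffD1])
    qed
    then show ?thesis using g(1) by blast
  qed
  then obtain g where g: "\<And>k. g k holomorphic_on S k"
      "\<And>k C. compact C \<Longrightarrow> C \<subseteq> S k \<Longrightarrow> uniform_limit C (F \<circ> diagseq) (g k) sequentially"
    by metis
  \<comment> \<open>As a pointwise limit, \<open>G\<close> agrees with each \<open>g k\<close> on
    \<open>S k\<close>, so that no compatibility between the \<open>g k\<close> has to be
    checked.\<close>
  define G where "G = (\<lambda>x. lim (\<lambda>n. (F \<circ> diagseq) n x))"
  have G: "G x = g k x" if "x \<in> S k" for x k
    unfolding G_def
    by (rule limI, rule tendsto_uniform_limitI[OF g(2)[of "{x}" k]]) (use that in auto)
  show thesis
  proof (rule that[OF subseq_diagseq])
    show "G holomorphic_on (\<Union>j. S j)"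
      using opn g(1) G by (intro holomorphic_on_UN_open) (auto cong: holomorphic_cong)
    fix C assume C: "compact C" "C \<subseteq> (\<Union>j. S j)"
    then obtain I where I: "finite I" "C \<subseteq> (\<Union>j\<in>I. S j)"
      using opn by (metis compactE_image)
    then obtain k where "\<And>i. i \<in> I \<Longrightarrow> i \<le> k" by (meson finite_nat_set_iff_bounded_le)
    then have "C \<subseteq> S k" using I mono by blast
    then show "uniform_limit C (F \<circ> diagseq) G sequentially"
      using g(2)[of C k] C(1) G by (metis (no_types, lifting) uniform_limit_cong' subsetD)
  qed
qed

section \<open>Limits of conformal maps of shrinking perforations\<close>

text \<open>The maps take values in the unit disk, so a subsequence converges on the punctured disk,
  and the bounded limit extends across 0. The extension vanishes at 0 because circles around the
  perforation meet every ray, and the maximum principle then makes the bound by 1 strict, as the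
  Schwarz lemma requires.\<close>

lemma perforated_disc_iso_normal:
  fixes \<epsilon> :: "nat \<Rightarrow> real"
  assumes iso: "\<And>n. perforated_disc_iso (K n) (K' n) (H n) (L n)"
    and K: "\<And>n. K n \<subseteq> ball 0 (\<epsilon> n)" and \<epsilon>: "\<epsilon> \<longlonglongrightarrow> 0"
    and hol: "\<And>n. H n holomorphic_on ball 0 1 - K n"
  obtains r G where "strict_mono (r :: nat \<Rightarrow> nat)" "G holomorphic_on ball 0 1" "G 0 = 0"
    "\<And>z. norm z < 1 \<Longrightarrow> norm (G z) < 1"
    "\<And>C. compact C \<Longrightarrow> C \<subseteq> ball 0 1 - {0} \<Longrightarrow> uniform_limit C (H \<circ> r) G sequentially"
proof -
  \<comment> \<open>These open annuli exhaust the punctured disk, and \<open>K n\<close> lies in the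
    removed closed disk as soon as \<open>\<epsilon> n\<close> is below its radius.\<close>
  define S where "S = (\<lambda>j::nat. ball 0 1 - cball (0::complex) (1 / (of_nat j + 1)))"
  have bound: "norm (H n z) < 1" if "z \<in> ball 0 1 - K n" for n z
    using perforated_disc_iso_inverse(1)[OF iso that] by simp
  have Seq: "(\<Union>j. S j) = ball 0 1 - {0}"
  proof
    show "ball 0 1 - {0} \<subseteq> (\<Union>j. S j)"
    proof
      fix z :: complex assume z: "z \<in> ball 0 1 - {0}"
      then obtain j where "inverse (of_nat (Suc j)) < norm z"
        using reals_Archimedean by (metis DiffD2 singletonI zero_less_norm_iff)
      then show "z \<in> (\<Union>j. S j)" using z by (auto simp: S_def field_simps not_le intro!: exI[of _ j])
    qed
  qed (auto simp: S_def)
  obtain r g where r: "strict_mono (r :: nat \<Rightarrow> nat)" and g: "g holomorphic_on (\<Union>j. S j)"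
    and lim: "\<And>C. compact C \<Longrightarrow> C \<subseteq> (\<Union>j. S j) \<Longrightarrow> uniform_limit C (H \<circ> r) g sequentially"
  proof (rule Montel_exhaustion[of S H 1])
    show "open (S j)" for j by (auto simp: S_def)
    show "S i \<subseteq> S j" if "i \<le> j" for i j
      using that unfolding S_def by (intro Diff_mono subset_cball) (auto simp: frac_le)
    show "\<forall>\<^sub>F n in sequentially. H n holomorphic_on S j \<and> (\<forall>z\<in>S j. norm (H n z) \<le> 1)" for j
    proof -
      have "\<forall>\<^sub>F n in sequentially. \<epsilon> n < 1 / (of_nat j + 1)"
        using \<epsilon> by (intro order_tendstoD) auto
      then show ?thesis
      proof eventually_elim
        case (elim n)
        then have "S j \<subseteq> ball 0 1 - K n" using K[of n] by (force simp: S_def)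
        then show ?case using hol[of n] bound[of _ n] holomorphic_on_subset less_imp_le by blast
      qed
    qed
  qed blast
  have eK: "\<forall>\<^sub>F n in sequentially. z \<notin> K (r n)" if "z \<noteq> 0" for z
  proof -
    have "(\<lambda>n. \<epsilon> (r n)) \<longlonglongrightarrow> 0" using LIMSEQ_subseq_LIMSEQ[OF \<epsilon> r] by (simp add: o_def)
    then have "\<forall>\<^sub>F n in sequentially. \<epsilon> (r n) < norm z" using that by (intro order_tendstoD) auto
    then show ?thesis by eventually_elim (use K in fastforce)
  qed
  have g1: "norm (g z) \<le> 1" if z: "z \<in> ball 0 1 - {0}" for z
  proof -
    have "(\<lambda>n. (H \<circ> r) n z) \<longlonglongrightarrow> g z"
      using tendsto_uniform_limitI[OF lim[of "{z}"]] z by (auto simp: Seq)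
    then have "(\<lambda>n. norm (H (r n) z)) \<longlonglongrightarrow> norm (g z)" by (intro tendsto_norm) simp
    moreover have "\<forall>\<^sub>F n in sequentially. norm (H (r n) z) \<le> 1"
    proof (rule eventually_mono)
      show "\<forall>\<^sub>F n in sequentially. z \<notin> K (r n)" using eK z by blast
    qed (use bound z in \<open>auto intro: less_imp_le\<close>)
    ultimately show ?thesis by (intro tendsto_upperbound) auto
  qed
  have "\<exists>G. G holomorphic_on ball 0 1 \<and> (\<forall>z\<in>ball 0 1 - {0}. G z = g z)"
  proof (subst holomorphic_on_extend_bounded)
    show "\<exists>B. \<forall>\<^sub>F z in at 0. norm (g z) \<le> B"
      using g1 by (auto intro!: exI[of _ 1] simp: eventually_at intro: exI[of _ "1::real"])
  qed (use g Seq in auto)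
  then obtain G where G: "G holomorphic_on ball 0 1" and Gg: "\<And>z. z \<in> ball 0 1 - {0} \<Longrightarrow> G z = g z"
    by blast
  have limG: "uniform_limit C (H \<circ> r) G sequentially" if "compact C" "C \<subseteq> ball 0 1 - {0}" for C
    using lim[of C] that Gg by (metis (no_types, lifting) Seq uniform_limit_cong' subsetD)
  have "isCont G 0"
    by (intro continuous_on_interior[OF holomorphic_on_imp_continuous_on[OF G]]) auto
  then have G0: "G 0 = 0"
    using LIMSEQ_subseq_LIMSEQ[OF \<epsilon> r] limG iso K
    by (intro perforated_disc_iso_limit_at_0[of "K \<circ> r" "K' \<circ> r" "H \<circ> r" "L \<circ> r" "\<epsilon> \<circ> r" G]) auto
  have G1: "norm (G z) \<le> 1" if "norm z < 1" for z
    using g1[of z] Gg[of z] G0 that by (cases "z = 0") auto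
  have "norm (G z) < 1" if z: "norm z < 1" for z
  proof (rule ccontr)
    assume "\<not> norm (G z) < 1"
    then have z1: "norm (G z) = 1" using G1[OF z] by simp
    have "G constant_on ball 0 1"
      using z z1 G1 by (intro maximum_modulus_principle[OF G, of "ball 0 1" z]) auto
    then have "G z = G 0" using z by (auto simp: constant_on_def)
    then show False using z1 G0 by simp
  qed
  then show thesis using that[OF r G G0] limG by blast
qed

section \<open>Limits are rotations\<close>

text \<open>On the connected collar from modulus \<open>\<rho>\<close> to the unit circle,
  \<open>norm (H z)\<close> exceeds \<open>t\<close> near the outer end. A value at most
  \<open>t\<close> would force the value \<open>t\<close> somewhere in the collar, but
  \<open>L\<close> takes the circle of radius \<open>t\<close> inside modulus
  \<open>\<rho>\<close>.\<close>

lemma perforated_disc_iso_outside_circle: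
  assumes iso: "perforated_disc_iso K K' H L"
    and K: "K \<subseteq> ball 0 \<rho>" and t: "t < 1"
    and L: "\<And>w. norm w = t \<Longrightarrow> norm (L w) < \<rho>" and z: "\<rho> \<le> norm z" "norm z < 1"
  shows "t < norm (H z)"
proof (rule ccontr)
  assume "\<not> t < norm (H z)"
  define V where "V = {z::complex. \<rho> \<le> norm (z - 0) \<and> norm (z - 0) < 1}"
  have V: "V \<subseteq> ball 0 1 - K" using K by (force simp: V_def)
  have "connected V" unfolding V_def by (rule connected_annulus) simp
  then have conn: "connected (H ` V)"
    using V iso unfolding perforated_disc_iso_def
    by (meson connected_continuous_image continuous_on_subset homeomorphism_def)
  obtain \<tau> where \<tau>: "\<tau> < 1" "\<And>z. z \<in> ball 0 1 - K \<Longrightarrow> \<tau> < norm z \<Longrightarrow> t < norm (H z)"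
    using iso t unfolding perforated_disc_iso_def by metis
  define x :: complex where "x = of_real ((max (norm z) \<tau> + 1) / 2)"
  have "0 \<le> max (norm z) \<tau>" by (simp add: le_max_iff_disj)
  then have nx: "norm x = (max (norm z) \<tau> + 1) / 2" unfolding x_def norm_of_real by simp
  have x: "norm z < norm x" "\<tau> < norm x" "norm x < 1"
    using \<tau>(1) z unfolding nx by (auto simp: max_def field_simps)
  have "x \<in> V" "z \<in> V" using x z by (auto simp: V_def)
  moreover have "t < norm (H x)" using \<open>x \<in> V\<close> V x(2) \<tau>(2) by blast
  ultimately obtain y where y: "y \<in> V" "norm (H y) = t"
    using connected_norm_ivt[OF conn, of "H z" "H x" t] \<open>\<not> t < norm (H z)\<close> by auto
  then have "L (H y) = y" using perforated_disc_iso_inverse(1)[OF iso] V by blast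
  then show False using L[OF y(2)] y(1) by (simp add: V_def)
qed

text \<open>Limits \<open>G\<close> of the maps and \<open>M\<close> of their inverses both satisfy
  the Schwarz inequality. At a single point \<open>w\<close> with \<open>M w\<close> nonzero,
  \<open>G (M w) = w\<close> gives equality in it, which already makes \<open>G\<close> a
  rotation.\<close>

lemma perforated_disc_iso_limit:
  fixes \<epsilon> r :: "nat \<Rightarrow> real"
  assumes iso: "\<And>n. perforated_disc_iso (K n) (cball 0 (r n)) (H n) (L n)"
    and K: "\<And>n. K n \<subseteq> ball 0 (\<epsilon> n)" and \<epsilon>: "\<epsilon> \<longlonglongrightarrow> 0"
    and hol: "\<And>n. H n holomorphic_on ball 0 1 - K n"
  obtains s \<alpha> where "strict_mono (s :: nat \<Rightarrow> nat)" "norm \<alpha> = 1"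
    "\<And>C. compact C \<Longrightarrow> C \<subseteq> ball 0 1 - {0} \<Longrightarrow> uniform_limit C (H \<circ> s) (\<lambda>z. \<alpha> * z) sequentially"
proof -
  note inv = perforated_disc_iso_inverse[OF iso]
  obtain s1 G where s1: "strict_mono (s1 :: nat \<Rightarrow> nat)" and G: "G holomorphic_on ball 0 1" "G 0 = 0"
    "\<And>z. norm z < 1 \<Longrightarrow> norm (G z) < 1" and
    limG: "\<And>C. compact C \<Longrightarrow> C \<subseteq> ball 0 1 - {0} \<Longrightarrow> uniform_limit C (H \<circ> s1) G sequentially"
    using perforated_disc_iso_normal[OF iso K \<epsilon> hol] by metis
  have contG: "continuous_on (ball 0 1) G" using G(1) by (rule holomorphic_on_imp_continuous_on)
  have limG1: "(\<lambda>n. H (s1 n) z) \<longlonglongrightarrow> G z" if "z \<in> ball 0 1 - {0}" for z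
    using tendsto_uniform_limitI[OF limG[of "{z}"]] that by auto
  have smallG: "\<exists>z\<in>ball 0 1 - {0}. norm (G z) < \<delta>" if "\<delta> > 0" for \<delta>
  proof -
    have "isCont G 0" by (intro continuous_on_interior[OF contG]) auto
    then obtain d where d: "d > 0" "\<And>z. dist z 0 < d \<Longrightarrow> dist (G z) (G 0) < \<delta>"
      using \<open>\<delta> > 0\<close> unfolding continuous_at_eps_delta by metis
    define x where "x = (of_real (min (d/2) (1/2)) :: complex)"
    have "norm x = min (d/2) (1/2)" using d unfolding x_def norm_of_real by simp
    then have "x \<in> ball 0 1 - {0}" "norm x < d" using d by auto
    then show ?thesis using d(2)[of x] G(2) by auto
  qed
  have \<epsilon>1: "(\<lambda>n. \<epsilon> (s1 n)) \<longlonglongrightarrow> 0" using LIMSEQ_subseq_LIMSEQ[OF \<epsilon> s1] by (simp add: o_def)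
  have r0: "0 \<le> r n" for n using iso[of n] unfolding perforated_disc_iso_def by simp
  \<comment> \<open>All values of \<open>H n\<close> have modulus above \<open>r n\<close>, whereas
    the limit \<open>G\<close> takes arbitrarily small values near 0. Thus the perforations on the
    image side shrink too, and the compactness argument applies to the inverses.\<close>
  have r1: "(\<lambda>n. r (s1 n)) \<longlonglongrightarrow> 0"
  proof (rule order_tendstoI)
    fix \<delta> :: real assume "\<delta> > 0"
    then obtain z where z: "z \<in> ball 0 1 - {0}" "norm (G z) < \<delta>" using smallG by blast
    have "\<forall>\<^sub>F n in sequentially. norm (H (s1 n) z) < \<delta>"
      using limG1[OF z(1)] z(2) by (intro order_tendstoD(2)[OF tendsto_norm])
    moreover have "\<forall>\<^sub>F n in sequentially. \<epsilon> (s1 n) < norm z"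
      using \<epsilon>1 z by (intro order_tendstoD) auto
    ultimately show "\<forall>\<^sub>F n in sequentially. r (s1 n) < \<delta>"
    proof eventually_elim
      case (elim n)
      then have "z \<in> ball 0 1 - K (s1 n)" using K[of "s1 n"] z by force
      then show ?case using inv(1)[of z "s1 n"] elim by auto
    qed
  qed (use r0 in \<open>auto intro!: always_eventually intro: less_le_trans\<close>)
  \<comment> \<open>So far \<open>L n\<close> is only a continuous inverse; it coincides with the
    holomorphic inverse of the injective holomorphic map \<open>H n\<close>.\<close>
  have holL: "L n holomorphic_on ball 0 1 - cball 0 (r n)" for n
  proof -
    have "open (ball 0 1 - K n)" using iso[of n] unfolding perforated_disc_iso_def
      by (simp add: compact_imp_closed open_Diff)
    moreover have "inj_on (H n) (ball 0 1 - K n)" using inv(1) by (metis inj_onI)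
    ultimately obtain g where g: "g holomorphic_on (H n ` (ball 0 1 - K n))"
        "\<And>z. z \<in> ball 0 1 - K n \<Longrightarrow> g (H n z) = z"
      using holomorphic_has_inverse[OF hol] by metis
    have "H n ` (ball 0 1 - K n) = ball 0 1 - cball 0 (r n)"
      using iso[of n] unfolding perforated_disc_iso_def homeomorphism_def by blast
    moreover have "L n w = g w" if "w \<in> ball 0 1 - cball 0 (r n)" for w
      using inv(2)[OF that] g(2) by metis
    ultimately show ?thesis using g(1) by (metis holomorphic_transform)
  qed
  \<comment> \<open>The positive summand makes room for the closed disk of radius
    \<open>r (s1 n)\<close> inside an open one.\<close>
  have rlim: "(\<lambda>n. r (s1 n) + 1 / (of_nat n + 1)) \<longlonglongrightarrow> 0"
    using tendsto_add[OF r1 LIMSEQ_inverse_real_of_nat] by (simp add: inverse_eq_divide add.commute)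
  obtain s2 M where s2: "strict_mono (s2 :: nat \<Rightarrow> nat)" and M: "M holomorphic_on ball 0 1" "M 0 = 0"
    "\<And>z. norm z < 1 \<Longrightarrow> norm (M z) < 1" and
    limM: "\<And>C. compact C \<Longrightarrow> C \<subseteq> ball 0 1 - {0} \<Longrightarrow> uniform_limit C (L \<circ> s1 \<circ> s2) M sequentially"
  proof (rule perforated_disc_iso_normal[of "\<lambda>n. cball 0 (r (s1 n))" "K \<circ> s1" "L \<circ> s1" "H \<circ> s1"
        "\<lambda>n. r (s1 n) + 1 / (of_nat n + 1)"])
    show "perforated_disc_iso (cball 0 (r (s1 n))) ((K \<circ> s1) n) ((L \<circ> s1) n) ((H \<circ> s1) n)" for n
      using perforated_disc_iso_sym[OF iso] by simp
    show "cball (0::complex) (r (s1 n)) \<subseteq> ball 0 (r (s1 n) + 1 / (of_nat n + 1))" for n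
    proof
      fix z :: complex assume "z \<in> cball 0 (r (s1 n))"
      moreover have "0 < 1 / (of_nat n + 1 :: real)" by simp
      ultimately show "z \<in> ball 0 (r (s1 n) + 1 / (of_nat n + 1))"
        unfolding mem_ball mem_cball by linarith
    qed
  qed (use holL rlim in \<open>simp_all add: o_def\<close>)
  define s where "s = s1 \<circ> s2"
  have s: "strict_mono s" unfolding s_def by (rule strict_mono_o[OF s1 s2])
  have lim: "uniform_limit C (H \<circ> s) G sequentially" if "compact C" "C \<subseteq> ball 0 1 - {0}" for C
    using limG[OF that] eventually_subseq[OF s2] unfolding uniform_limit_iff s_def by fastforce
  have limM1: "(\<lambda>n. L (s n) w) \<longlonglongrightarrow> M w" if "w \<in> ball 0 1 - {0}" for w
    using tendsto_uniform_limitI[OF limM[of "{w}"]] that by (auto simp: s_def)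
  have eK: "\<forall>\<^sub>F n in sequentially. \<epsilon> (s n) < \<delta>" if "\<delta> > 0" for \<delta>
    using LIMSEQ_subseq_LIMSEQ[OF \<epsilon> s] that by (intro order_tendstoD) (auto simp: o_def)
  have er: "\<forall>\<^sub>F n in sequentially. r (s n) < \<delta>" if "\<delta> > 0" for \<delta>
    using LIMSEQ_subseq_LIMSEQ[OF r1 s2] that by (intro order_tendstoD) (auto simp: o_def s_def)
  \<comment> \<open>Choose \<open>z\<close> with \<open>norm (G z) < 1/2\<close>. If
    \<open>M\<close> vanished, the inverses would take the circle of radius 1/2 inside modulus
    \<open>norm z\<close>, which pushes \<open>norm (H (s n) z)\<close> above 1/2 and contradicts
    the limit.\<close>
  have "\<exists>w\<in>ball 0 1 - {0}. M w \<noteq> 0"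
  proof (rule ccontr)
    assume "\<not> ?thesis"
    then have M0: "\<And>w. w \<in> ball 0 1 - {0} \<Longrightarrow> M w = 0" by blast
    have "0 < (1/2::real)" by simp
    then obtain z where z: "z \<in> ball 0 1 - {0}" "norm (G z) < 1/2" using smallG by blast
    have "uniform_limit (sphere 0 (1/2)) (L \<circ> s1 \<circ> s2) M sequentially" by (intro limM) auto
    then have "\<forall>\<^sub>F n in sequentially. \<forall>w\<in>sphere 0 (1/2). dist (L (s n) w) (M w) < norm z"
      using z unfolding uniform_limit_iff s_def by auto
    moreover have "\<forall>\<^sub>F n in sequentially. \<epsilon> (s n) < norm z" using z by (intro eK) auto
    ultimately have "\<forall>\<^sub>F n in sequentially. 1/2 \<le> norm (H (s n) z)"
    proof eventually_elim
      case (elim n)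
      have "norm (L (s n) w) < norm z" if "norm w = 1/2" for w
      proof -
        have "w \<noteq> 0" using that by auto
        then have "M w = 0" "w \<in> sphere 0 (1/2)" using M0[of w] that by auto
        then show ?thesis using elim(1) by (metis dist_0_norm dist_commute)
      qed
      moreover have "K (s n) \<subseteq> ball 0 (norm z)" using K[of "s n"] elim(2) by force
      ultimately have "1/2 < norm (H (s n) z)"
        using perforated_disc_iso_outside_circle[OF iso, of "s n" "norm z" "1/2" z] z by auto
      then show ?case by simp
    qed
    moreover have "(\<lambda>n. norm (H (s n) z)) \<longlonglongrightarrow> norm (G z)"
      using tendsto_uniform_limitI[OF lim[of "{z}"]] z by (intro tendsto_norm) auto
    ultimately have "1/2 \<le> norm (G z)" by (intro tendsto_lowerbound) auto
    then show False using z by simp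
  qed
  then obtain w where w: "w \<in> ball 0 1 - {0}" "M w \<noteq> 0" by blast
  have w1: "norm w < 1" using w by simp
  define z where "z = M w"
  have z: "z \<in> ball 0 1 - {0}" "norm z \<le> norm w"
    using M(3)[OF w1] w Schwarz_Lemma(1)[OF M w1] by (auto simp: z_def)
  have zlim: "(\<lambda>n. L (s n) w) \<longlonglongrightarrow> z" unfolding z_def by (rule limM1[OF w(1)])
  have "open (ball 0 1 - {0::complex})" by auto
  then obtain d where d: "d > 0" "cball z d \<subseteq> ball 0 1 - {0}" using z open_contains_cball by blast
  have "(\<lambda>n. G (L (s n) w)) \<longlonglongrightarrow> G z"
    using z by (intro isCont_tendsto_compose[OF _ zlim] continuous_on_interior[OF contG]) auto
  \<comment> \<open>The arguments \<open>L (s n) w\<close> move with \<open>n\<close>, so uniformity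
    is needed: eventually they stay in \<open>cball z d\<close>, where \<open>H (s n)\<close> is
    uniformly close to \<open>G\<close>, and there \<open>H (s n) (L (s n) w) = w\<close>.\<close>
  moreover have "(\<lambda>n. G (L (s n) w)) \<longlonglongrightarrow> w"
  proof (rule tendstoI)
    fix e :: real assume "e > 0"
    have "\<forall>\<^sub>F n in sequentially. dist (L (s n) w) z < d" using zlim d by (intro tendstoD) auto
    moreover have "\<forall>\<^sub>F n in sequentially. \<forall>x\<in>cball z d. dist ((H \<circ> s) n x) (G x) < e"
      using lim[of "cball z d"] d \<open>e > 0\<close> unfolding uniform_limit_iff by auto
    moreover have "\<forall>\<^sub>F n in sequentially. r (s n) < norm w" using w by (intro er) auto
    ultimately show "\<forall>\<^sub>F n in sequentially. dist (G (L (s n) w)) w < e"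
    proof eventually_elim
      case (elim n)
      then have "w \<in> ball 0 1 - cball 0 (r (s n))" using w by auto
      then have "H (s n) (L (s n) w) = w" using inv(2) by blast
      moreover have "L (s n) w \<in> cball z d" using elim(1) by (simp add: dist_commute)
      then have "dist ((H \<circ> s) n (L (s n) w)) (G (L (s n) w)) < e" using elim(2) by blast
      ultimately show ?case by (simp add: dist_commute)
    qed
  qed
  ultimately have "G z = w" using LIMSEQ_unique by blast
  \<comment> \<open>The chain is
    \<open>norm w = norm (G z) \<le> norm z \<le> norm w\<close>.\<close>
  then have "norm (G z) = norm z"
    using z Schwarz_Lemma(1)[OF G(1,2,3), of z] by auto
  then obtain \<alpha> where \<alpha>: "\<And>z. norm z < 1 \<Longrightarrow> G z = \<alpha> * z" "norm \<alpha> = 1"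
    using Schwarz_Lemma(3)[OF G(1,2,3), of z] z by force
  have "uniform_limit C (H \<circ> s) (\<lambda>z. \<alpha> * z) sequentially"
    if C: "compact C" "C \<subseteq> ball 0 1 - {0}" for C
  proof -
    have "G z = \<alpha> * z" if "z \<in> C" for z using \<alpha>(1) that C(2) by auto
    then show ?thesis using lim[OF C] by (metis (no_types, lifting) uniform_limit_cong')
  qed
  then show thesis using that[OF s \<alpha>(2)] by blast
qed

section \<open>Orientation\<close>

lemma connected_norm_dichotomy:
  fixes S :: "'a::real_normed_vector set"
  assumes "connected S" "\<And>z. z \<in> S \<Longrightarrow> norm z \<noteq> s"
  shows "(\<forall>z\<in>S. s < norm z) \<or> (\<forall>z\<in>S. norm z < s)"
  using connected_norm_ivt[OF assms(1)] assms(2) by (metis linorder_le_less_linear less_imp_le)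

lemma compact_subset_ball_norm_bound:
  fixes C :: "complex set"
  assumes "compact C" "C \<subseteq> ball 0 1"
  shows "\<exists>\<rho><1. \<forall>z\<in>C. norm z \<le> \<rho>"
proof (cases "C = {}")
  case False
  then obtain x where "x \<in> C" "\<forall>y\<in>C. norm y \<le> norm x"
    using continuous_attains_sup[OF assms(1) _ continuous_on_norm_id] by blast
  then show ?thesis using assms(2) by (intro exI[of _ "norm x"]) auto
qed (auto intro: exI[of _ 0])

lemma compact_closed_annulus: "compact {w::complex. a \<le> norm w \<and> norm w \<le> b}"
proof -
  have "{w::complex. a \<le> norm w \<and> norm w \<le> b} = cball 0 b - ball 0 a" by auto
  then show ?thesis by (simp add: compact_diff)
qed

text \<open>It suffices that \<open>L\<close> takes some collar of the unit circle outside the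
  circle of radius \<open>s\<close>: compactness improves this to the full condition on
  \<open>L\<close>. The condition on \<open>H\<close> holds because the collar at the inner circle
  then has to go inside that circle.\<close>

lemma perforated_disc_isoI:
  assumes K: "compact K" "0 \<in> K" "K \<subseteq> ball 0 s" "s < 1" and r: "0 < r" "r < 1"
    and hom: "homeomorphism (ball 0 1 - K) (ball 0 1 - cball 0 r) H L"
    and b: "b < 1" "\<And>w. b < norm w \<Longrightarrow> r < norm w \<Longrightarrow> norm w < 1 \<Longrightarrow> s < norm (L w)"
  shows "perforated_disc_iso K (cball 0 r) H L"
proof -
  have H: "z \<in> ball 0 1 - K \<Longrightarrow> H z \<in> ball 0 1 - cball 0 r \<and> L (H z) = z" for z
    using hom unfolding homeomorphism_def by blast
  have L: "w \<in> ball 0 1 - cball 0 r \<Longrightarrow> L w \<in> ball 0 1 - K \<and> H (L w) = w" for w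
    using hom unfolding homeomorphism_def by blast
  have contH: "continuous_on (ball 0 1 - K) H" and contL: "continuous_on (ball 0 1 - cball 0 r) L"
    using hom unfolding homeomorphism_def by auto
  have s0: "0 < s" using K(2,3) by auto
  define C where "C = (\<lambda>t. {z::complex. s \<le> norm z \<and> norm z \<le> t})"
  have Csub: "C t \<subseteq> ball 0 1 - K" if "t < 1" for t using K(3) that by (auto simp: C_def)
  have HC: "compact (H ` C t)" if "t < 1" for t
    using compact_closed_annulus Csub[OF that] contH unfolding C_def
    by (intro compact_continuous_image) (auto intro: continuous_on_subset)
  have outL: "\<exists>\<rho><1. \<forall>w\<in>ball 0 1 - cball 0 r. \<rho> < norm w \<longrightarrow> t < norm (L w)" if t: "t < 1" for t
  proof -
    have "H ` C t \<subseteq> ball 0 1" using Csub[OF t] H by blast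
    then obtain \<rho> where \<rho>: "\<rho> < 1" "\<And>w. w \<in> H ` C t \<Longrightarrow> norm w \<le> \<rho>"
      using compact_subset_ball_norm_bound[OF HC[OF t]] by blast
    have "t < norm (L w)" if w: "w \<in> ball 0 1 - cball 0 r" "max b \<rho> < norm w" for w
    proof (rule ccontr)
      assume "\<not> t < norm (L w)"
      moreover have "s < norm (L w)" using b(2)[of w] w by auto
      ultimately have "L w \<in> C t" by (simp add: C_def)
      then have "w \<in> H ` C t" using L[OF w(1)] by (metis imageI)
      then show False using \<rho>(2) w(2) by force
    qed
    then show ?thesis using \<rho>(1) b(1) by (intro exI[of _ "max b \<rho>"]) auto
  qed
  \<comment> \<open>Here \<open>C s\<close> is the circle of radius \<open>s\<close>, and
    \<open>a\<close> will be the least modulus on its image. Hence \<open>L\<close> maps the inner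
    collar \<open>V\<close> off this circle, so to one side of it.\<close>
  have "C s \<noteq> {}" using s0 by (auto simp: C_def intro!: exI[of _ "of_real s"])
  then obtain x where x: "x \<in> H ` C s" "\<And>y. y \<in> H ` C s \<Longrightarrow> norm x \<le> norm y"
    using continuous_attains_inf[OF HC[OF K(4)] _ continuous_on_norm_id] by blast
  define a where "a = norm x"
  have a: "r < a" "a < 1" using x(1) H Csub[OF K(4)] by (force simp: a_def)+
  define B where "B = (\<lambda>t. {w::complex. a \<le> norm w \<and> norm w \<le> t})"
  have Bsub: "B t \<subseteq> ball 0 1 - cball 0 r" if "t < 1" for t using a(1) that by (auto simp: B_def)
  have LB: "compact (L ` B t)" if "t < 1" for t
    using compact_closed_annulus Bsub[OF that] contL unfolding B_def
    by (intro compact_continuous_image) (auto intro: continuous_on_subset)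
  define V where "V = {w::complex. r < norm (w - 0) \<and> norm (w - 0) < a}"
  have Vsub: "V \<subseteq> ball 0 1 - cball 0 r" using a by (auto simp: V_def)
  have "connected V" unfolding V_def by (rule connected_annulus) simp
  then have "connected (L ` V)"
    using contL Vsub by (intro connected_continuous_image) (auto intro: continuous_on_subset)
  moreover have "norm (L w) \<noteq> s" if "w \<in> V" for w
  proof
    assume "norm (L w) = s"
    then have "L w \<in> C s" by (simp add: C_def)
    moreover have "w \<in> ball 0 1 - cball 0 r" using Vsub that by blast
    ultimately have "w \<in> H ` C s" using L by (metis imageI)
    then have "a \<le> norm w" using x(2) by (simp add: a_def)
    then show False using that by (simp add: V_def)
  qed
  ultimately have dich: "(\<forall>w\<in>V. s < norm (L w)) \<or> (\<forall>w\<in>V. norm (L w) < s)"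
    using connected_norm_dichotomy[of "L ` V" s] by blast
  have Vin: "norm (L w) < s" if "w \<in> V" for w
  proof (rule ccontr)
    assume "\<not> norm (L w) < s"
    then have V: "\<And>w. w \<in> V \<Longrightarrow> s < norm (L w)" using dich that by blast
    have sub: "ball 0 s - K \<subseteq> L ` B b"
    proof
      fix z assume z: "z \<in> ball 0 s - K"
      then have Hz: "H z \<in> ball 0 1 - cball 0 r" "L (H z) = z" using H[of z] K(4) by auto
      have "\<not> b < norm (H z)" using b(2)[of "H z"] Hz z by auto
      moreover have "H z \<notin> V" using V[of "H z"] Hz z by auto
      ultimately have "H z \<in> B b" using Hz by (auto simp: V_def B_def)
      then show "z \<in> L ` B b" using Hz by (metis imageI)
    qed
    have "K \<inter> L ` B b \<inter> ball 0 s = {}" using L Bsub[OF b(1)] by blast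
    moreover have "ball 0 s \<subseteq> K \<union> L ` B b" using sub by blast
    moreover have "K \<inter> ball 0 s \<noteq> {}" using K(2) s0 by auto
    ultimately have "ball 0 s \<inter> L ` B b = {}"
      using connected_closedD[OF connected_ball[of 0 s] _ _ compact_imp_closed[OF K(1)]
          compact_imp_closed[OF LB[OF b(1)]]] by blast
    then have "ball 0 s = K" using sub K(3) by blast
    then have "closed (ball (0::complex) s)" using K(1) compact_imp_closed by blast
    then have "ball (0::complex) s = cball 0 s" using closure_ball[OF s0] closure_closed by metis
    moreover have "of_real s \<in> cball (0::complex) s" "of_real s \<notin> ball (0::complex) s" using s0 by auto
    ultimately show False by blast
  qed
  have outH: "\<exists>\<rho><1. \<forall>z\<in>ball 0 1 - K. \<rho> < norm z \<longrightarrow> t < norm (H z)" if t: "t < 1" for t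
  proof -
    have "L ` B t \<subseteq> ball 0 1" using Bsub[OF t] L by blast
    then obtain \<rho> where \<rho>: "\<rho> < 1" "\<And>z. z \<in> L ` B t \<Longrightarrow> norm z \<le> \<rho>"
      using compact_subset_ball_norm_bound[OF LB[OF t]] by blast
    have "t < norm (H z)" if z: "z \<in> ball 0 1 - K" "max s \<rho> < norm z" for z
    proof (rule ccontr)
      assume "\<not> t < norm (H z)"
      moreover have "z \<notin> L ` B t" using \<rho>(2) z(2) by force
      then have "H z \<notin> B t" using H[OF z(1)] by (metis imageI)
      ultimately have "H z \<in> V" using H[OF z(1)] by (auto simp: B_def V_def)
      then show False using Vin H[OF z(1)] z(2) by force
    qed
    then show ?thesis using \<rho>(1) K(4) by (intro exI[of _ "max s \<rho>"]) auto
  qed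
  show ?thesis unfolding perforated_disc_iso_def using K r hom outH outL by (auto intro: less_trans)
qed

text \<open>If neither end of the round annulus corresponded to the unit circle, the region
  \<open>s < |z| < 1\<close> would lie in a compact subset of the disk.\<close>

lemma perforated_disc_orientation:
  assumes K: "compact K" "0 \<in> K" "K \<subseteq> ball 0 1" and r: "0 < r" "r < 1"
    and hom: "homeomorphism (ball 0 1 - K) (ball 0 1 - cball 0 r) H L"
  shows "perforated_disc_iso K (cball 0 r) H L \<or>
    perforated_disc_iso K (cball 0 r) (\<lambda>z. of_real r / H z) (\<lambda>w. L (of_real r / w))"
proof -
  define Y where "Y = ball 0 1 - cball (0::complex) r"
  have H: "z \<in> ball 0 1 - K \<Longrightarrow> H z \<in> Y \<and> L (H z) = z" for z
    using hom unfolding homeomorphism_def Y_def by blast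
  have L: "w \<in> Y \<Longrightarrow> L w \<in> ball 0 1 - K \<and> H (L w) = w" for w
    using hom unfolding homeomorphism_def Y_def by blast
  have contH: "continuous_on (ball 0 1 - K) H" and contL: "continuous_on Y L"
    using hom unfolding homeomorphism_def Y_def by auto
  obtain m where m: "m < 1" "\<And>z. z \<in> K \<Longrightarrow> norm z \<le> m"
    using compact_subset_ball_norm_bound[OF K(1,3)] by blast
  define s where "s = (m + 1) / 2"
  have "0 \<le> m" using m(2)[OF K(2)] by simp
  then have s: "0 < s" "s < 1" "m < s" using m(1) by (auto simp: s_def)
  have Ks: "K \<subseteq> ball 0 s" using m(2) s by force
  have Ss: "sphere 0 s \<subseteq> ball 0 1 - K" using Ks s by auto
  have cS: "compact (H ` sphere 0 s)"
    using Ss contH by (intro compact_continuous_image) (auto intro: continuous_on_subset)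
  have SY: "H ` sphere 0 s \<subseteq> Y" using H Ss by blast
  have "sphere (0::complex) s \<noteq> {}" using s by simp
  then have ne: "H ` sphere 0 s \<noteq> {}" by blast
  \<comment> \<open>The extreme moduli \<open>a\<close> and \<open>b\<close> on the image of the
    circle of radius \<open>s\<close> delimit the two end collars \<open>V2\<close> and
    \<open>V1\<close>; \<open>L\<close> maps each of them off that circle, so wholly to one
    side.\<close>
  obtain x where x: "x \<in> H ` sphere 0 s" "\<And>y. y \<in> H ` sphere 0 s \<Longrightarrow> norm x \<le> norm y"
    using continuous_attains_inf[OF cS ne continuous_on_norm_id] by blast
  obtain y where y: "y \<in> H ` sphere 0 s" "\<And>x. x \<in> H ` sphere 0 s \<Longrightarrow> norm x \<le> norm y"
    using continuous_attains_sup[OF cS ne continuous_on_norm_id] by blast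
  define a where "a = norm x"
  define b where "b = norm y"
  have ab: "r < a" "a \<le> b" "b < 1" using x y SY by (auto simp: a_def b_def Y_def)
  have S: "a \<le> norm w \<and> norm w \<le> b" if "w \<in> Y" "norm (L w) = s" for w
  proof -
    have "L w \<in> sphere 0 s" using that(2) by simp
    then have "w \<in> H ` sphere 0 s" using L[OF that(1)] by (metis imageI)
    then show ?thesis using x(2) y(2) by (simp add: a_def b_def)
  qed
  have dich: "(\<forall>w\<in>V. s < norm (L w)) \<or> (\<forall>w\<in>V. norm (L w) < s)"
    if V: "connected V" "V \<subseteq> Y" "\<And>w. w \<in> V \<Longrightarrow> norm w < a \<or> b < norm w" for V
  proof -
    have "connected (L ` V)"
      using contL V by (intro connected_continuous_image) (auto intro: continuous_on_subset)
    moreover have "norm (L w) \<noteq> s" if "w \<in> V" for w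
      using S[of w] V(2,3) that by force
    ultimately show ?thesis using connected_norm_dichotomy[of "L ` V" s] by blast
  qed
  define V1 where "V1 = {w::complex. b < norm (w - 0) \<and> norm (w - 0) < 1}"
  define V2 where "V2 = {w::complex. r < norm (w - 0) \<and> norm (w - 0) < a}"
  have conn: "connected V1" "connected V2"
    unfolding V1_def V2_def by (rule connected_annulus, simp)+
  have d1: "(\<forall>w\<in>V1. s < norm (L w)) \<or> (\<forall>w\<in>V1. norm (L w) < s)"
    using conn ab by (intro dich) (auto simp: V1_def Y_def)
  have d2: "(\<forall>w\<in>V2. s < norm (L w)) \<or> (\<forall>w\<in>V2. norm (L w) < s)"
    using conn ab by (intro dich) (auto simp: V2_def Y_def)
  have "(\<forall>w\<in>V1. s < norm (L w)) \<or> (\<forall>w\<in>V2. s < norm (L w))"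
  proof (rule ccontr)
    assume "\<not> ?thesis"
    then have lt: "\<And>w. w \<in> V1 \<union> V2 \<Longrightarrow> norm (L w) < s" using d1 d2 by blast
    define B where "B = {w::complex. a \<le> norm w \<and> norm w \<le> b}"
    have BY: "B \<subseteq> Y" using ab by (auto simp: B_def Y_def)
    have LB: "compact (L ` B)"
      using BY contL compact_closed_annulus[of a b] unfolding B_def
      by (intro compact_continuous_image) (auto intro: continuous_on_subset)
    have "L ` B \<subseteq> ball 0 1" using BY L by blast
    then obtain \<rho> where \<rho>: "\<rho> < 1" "\<And>z. z \<in> L ` B \<Longrightarrow> norm z \<le> \<rho>"
      using compact_subset_ball_norm_bound[OF LB] by blast
    define t where "t = (max s \<rho> + 1) / 2"
    have t: "s < t" "\<rho> < t" "t < 1" using \<rho>(1) s by (auto simp: t_def)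
    define z where "z = (of_real t :: complex)"
    have nz: "norm z = t" using t s by (simp add: z_def)
    then have zX: "z \<in> ball 0 1 - K" using t Ks by force
    have "H z \<notin> V1 \<union> V2" using lt[of "H z"] H[OF zX] nz t by force
    then have "H z \<in> B" using H[OF zX] by (auto simp: V1_def V2_def B_def Y_def)
    then have "z \<in> L ` B" using H[OF zX] by (metis imageI)
    then show False using \<rho>(2) nz t by force
  qed
  then show ?thesis
  proof
    assume "\<forall>w\<in>V1. s < norm (L w)"
    then have "perforated_disc_iso K (cball 0 r) H L"
      using K Ks s r hom ab by (intro perforated_disc_isoI[of K s r H L b]) (auto simp: V1_def)
    then show ?thesis ..
  next
    \<comment> \<open>The involution of \<open>Y\<close> given by \<open>r / w\<close> exchanges the
      two ends: it takes moduli between \<open>r / a\<close> and 1 into \<open>V2\<close>, which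
      yields the required outer collar.\<close>
    assume V2: "\<forall>w\<in>V2. s < norm (L w)"
    have inv: "of_real r / w \<in> Y" "of_real r / (of_real r / w) = w" if "w \<in> Y" for w :: complex
    proof -
      have w: "r < norm w" "norm w < 1" "w \<noteq> 0" using that r by (auto simp: Y_def)
      have "r < r / norm w" "r / norm w < 1"
        using w r by (simp_all add: less_divide_eq divide_less_eq mult_less_cancel_left2)
      then show "of_real r / w \<in> Y" using r by (simp add: Y_def norm_divide)
      show "of_real r / (of_real r / w) = w" using w r by simp
    qed
    have "homeomorphism Y Y (\<lambda>w. of_real r / w) (\<lambda>w. of_real r / w)"
    proof
      show "continuous_on Y (\<lambda>w. complex_of_real r / w)"
        by (intro continuous_intros) (use r in \<open>auto simp: Y_def\<close>)
      then show "continuous_on Y (\<lambda>w. complex_of_real r / w)" .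
    qed (use inv in auto)
    then have "homeomorphism (ball 0 1 - K) Y ((\<lambda>w. of_real r / w) \<circ> H) (L \<circ> (\<lambda>w. of_real r / w))"
      using hom unfolding Y_def by (rule homeomorphism_compose[rotated])
    then have "homeomorphism (ball 0 1 - K) (ball 0 1 - cball 0 r) (\<lambda>z. of_real r / H z) (\<lambda>w. L (of_real r / w))"
      by (simp add: o_def Y_def)
    moreover have "s < norm (L (of_real r / w))" if "r / a < norm w" "r < norm w" "norm w < 1" for w
    proof -
      have "w \<noteq> 0" using that r by auto
      then have "of_real r / w \<in> V2" using that r ab
        by (auto simp: V2_def norm_divide field_simps)
      then show ?thesis using V2 by blast
    qed
    moreover have "r / a < 1" using ab r by simp
    ultimately have "perforated_disc_iso K (cball 0 r) (\<lambda>z. of_real r / H z) (\<lambda>w. L (of_real r / w))"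
      using K Ks s r by (intro perforated_disc_isoI[of K s r _ _ "r / a"]) auto
    then show ?thesis ..
  qed
qed

section \<open>The normalized limit\<close>

lemma Riemann_map_at:
  assumes "open S" "simply_connected S" "S \<noteq> UNIV" "p \<in> S"
  obtains f g where "f holomorphic_on S" "g holomorphic_on ball 0 1" "f p = 0"
    "\<And>z. z \<in> S \<Longrightarrow> f z \<in> ball 0 1 \<and> g (f z) = z"
    "\<And>z. z \<in> ball 0 1 \<Longrightarrow> g z \<in> S \<and> f (g z) = z"
proof -
  have "\<exists>f g. f holomorphic_on S \<and> g holomorphic_on ball 0 1 \<and>
      (\<forall>z\<in>S. f z \<in> ball 0 1 \<and> g (f z) = z) \<and> (\<forall>z\<in>ball 0 1. g z \<in> S \<and> f (g z) = z)"
    using Riemann_mapping_theorem[of S] assms by (metis empty_iff)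
  then obtain f g where f: "f holomorphic_on S" and g: "g holomorphic_on ball 0 1"
    and fg: "\<And>z. z \<in> S \<Longrightarrow> f z \<in> ball 0 1 \<and> g (f z) = z"
    and gf: "\<And>z. z \<in> ball 0 1 \<Longrightarrow> g z \<in> S \<and> f (g z) = z"
    by blast
  obtain h k where hk: "h (f p) = 0"
      "h holomorphic_on ball 0 1" "h ` ball 0 1 \<subseteq> ball 0 1"
      "k holomorphic_on ball 0 1" "k ` ball 0 1 \<subseteq> ball 0 1"
      "\<And>z. z \<in> ball 0 1 \<Longrightarrow> h (k z) = z" "\<And>z. z \<in> ball 0 1 \<Longrightarrow> k (h z) = z"
    using ball_biholomorphism_exists[of "f p"] fg[OF assms(4)] by metis
  show thesis
  proof (rule that[of "h \<circ> f" "g \<circ> k"])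
    show "h \<circ> f holomorphic_on S"
      by (rule holomorphic_on_compose_gen[OF f hk(2)]) (use fg in blast)
    show "g \<circ> k holomorphic_on ball 0 1"
      by (rule holomorphic_on_compose_gen[OF hk(4) g]) (use hk in blast)
    show "(h \<circ> f) z \<in> ball 0 1 \<and> (g \<circ> k) ((h \<circ> f) z) = z" if "z \<in> S" for z
    proof -
      have "f z \<in> ball 0 1" "g (f z) = z" using fg[OF that] by auto
      moreover from this have "h (f z) \<in> ball 0 1" "k (h (f z)) = f z" using hk(3,7) by blast+
      ultimately show ?thesis by (simp only: o_apply)
    qed
    show "(g \<circ> k) z \<in> S \<and> (h \<circ> f) ((g \<circ> k) z) = z" if "z \<in> ball 0 1" for z
    proof -
      have "k z \<in> ball 0 1" "h (k z) = z" using hk(5,6) that by blast+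
      moreover from this have "g (k z) \<in> S" "f (g (k z)) = k z" using gf by blast+
      ultimately show ?thesis by (simp only: o_apply)
    qed
  qed (use hk in simp)
qed

section \<open>Inversion and affine maps on round annuli\<close>

lemma inversion_round_annulus:
  assumes "1 < R"
  shows "inversion ` round_annulus 0 1 R = round_annulus 0 (1 / R) 1"
proof
  show "inversion ` round_annulus 0 1 R \<subseteq> round_annulus 0 (1 / R) 1"
  proof
    fix w assume "w \<in> inversion ` round_annulus 0 1 R"
    then obtain z where z: "1 < norm z" "norm z < R" "w = 1 / z"
      by (auto simp: round_annulus_def inversion_def)
    then have "0 < norm z" by linarith
    moreover have "norm w = 1 / norm z" using z by (simp add: norm_divide)
    moreover have "1 / R < 1 / norm z" "1 / norm z < 1"
      using z assms \<open>0 < norm z\<close> by (simp_all add: divide_less_eq less_divide_eq)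
    ultimately show "w \<in> round_annulus 0 (1 / R) 1" by (simp add: round_annulus_def)
  qed
  show "round_annulus 0 (1 / R) 1 \<subseteq> inversion ` round_annulus 0 1 R"
  proof
    fix w assume "w \<in> round_annulus 0 (1 / R) 1"
    then have w: "1 / R < norm w" "norm w < 1" by (auto simp: round_annulus_def)
    then have "0 < norm w" using assms by (meson less_trans zero_less_divide_1_iff zero_less_one)
    then have "inversion w \<in> round_annulus 0 1 R"
      using w assms by (auto simp: round_annulus_def inversion_def norm_divide field_simps)
    moreover have "inversion (inversion w) = w" by (simp add: inversion_def)
    ultimately show "w \<in> inversion ` round_annulus 0 1 R" by (metis imageI)
  qed
qed

lemma affine_image_round_annulus:
  assumes "a \<noteq> 0"
  shows "(\<lambda>w. a * w + b) ` round_annulus 0 r R = round_annulus b (norm a * r) (norm a * R)"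
proof
  show "(\<lambda>w. a * w + b) ` round_annulus 0 r R \<subseteq> round_annulus b (norm a * r) (norm a * R)"
    using assms by (auto simp: round_annulus_def norm_mult)
  show "round_annulus b (norm a * r) (norm a * R) \<subseteq> (\<lambda>w. a * w + b) ` round_annulus 0 r R"
  proof
    fix w assume "w \<in> round_annulus b (norm a * r) (norm a * R)"
    then have "(w - b) / a \<in> round_annulus 0 r R"
      using assms by (auto simp: round_annulus_def norm_divide field_simps)
    moreover have "w = a * ((w - b) / a) + b" using assms by simp
    ultimately show "w \<in> (\<lambda>w. a * w + b) ` round_annulus 0 r R" by (rule rev_image_eqI)
  qed
qed

text \<open>The involution \<open>w \<mapsto> r/w\<close> of the round annulus corrects the orientation, should \<open>\<Phi>\<close> map
  the outer end of \<^term>\<open>ball 0 1 - K\<close> to the outer circle.\<close>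

lemma oriented_annulus_map:
  assumes K: "compact K" "0 \<in> K" "K \<subseteq> ball 0 1" and R: "1 < R"
    and \<Phi>: "holomorphic_homeomorphism \<Phi> (ball 0 1 - K) (round_annulus 0 1 R)"
  obtains j L where "j holomorphic_on inversion ` round_annulus 0 1 R"
    "inj_on j (inversion ` round_annulus 0 1 R)"
    "j ` inversion ` round_annulus 0 1 R = round_annulus 0 (1 / R) 1"
    "perforated_disc_iso K (cball 0 (1 / R)) (j \<circ> inversion \<circ> \<Phi>) L"
proof -
  let ?B = "round_annulus 0 (1 / R) 1"
  have B: "?B = ball 0 1 - cball 0 (1 / R)" by (auto simp: round_annulus_def)
  have B0: "w \<noteq> 0" if "w \<in> ?B" for w using that R by (auto simp: round_annulus_def)
  note img = inversion_round_annulus[OF R]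
  have inv: "1 / of_real R / w \<in> ?B" "1 / of_real R / (1 / of_real R / w) = w" if "w \<in> ?B" for w
  proof -
    have w: "1 / R < norm w" "norm w < 1" "w \<noteq> 0" using that B0[OF that] by (auto simp: round_annulus_def)
    have "1 / R < 1 / R / norm w" "1 / R / norm w < 1"
      using w R by (simp_all add: less_divide_eq divide_less_eq field_simps)
    moreover have "norm (1 / of_real R / w) = 1 / R / norm w" using R by (simp add: norm_divide norm_mult)
    ultimately show "1 / of_real R / w \<in> ?B" unfolding round_annulus_def by simp
    show "1 / of_real R / (1 / of_real R / w) = w" using w R by simp
  qed
  obtain \<Psi> where h: "homeomorphism (ball 0 1 - K) (round_annulus 0 1 R) \<Phi> \<Psi>"
    using \<Phi> unfolding holomorphic_homeomorphism_def by blast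
  \<comment> \<open>Scaling moves the outer circle to the unit circle, so that the orientation
    alternative applies with inner radius \<open>1 / R\<close>.\<close>
  have "homeomorphism (round_annulus 0 1 R) ?B (\<lambda>w. w / of_real R) (\<lambda>w. w * of_real R)"
  proof
    show "(\<lambda>w. w / of_real R) ` round_annulus 0 1 R \<subseteq> ?B"
      using R by (auto simp: round_annulus_def norm_divide divide_strict_right_mono)
    show "(\<lambda>w. w * of_real R) ` ?B \<subseteq> round_annulus 0 1 R"
      using R by (auto simp: round_annulus_def norm_mult field_simps)
  qed (use R in \<open>auto intro!: continuous_intros\<close>)
  from homeomorphism_compose[OF h this]
  have "homeomorphism (ball 0 1 - K) (ball 0 1 - cball 0 (1 / R))
      (\<lambda>z. \<Phi> z / of_real R) (\<lambda>w. \<Psi> (w * of_real R))"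
    by (simp add: B o_def)
  from perforated_disc_orientation[OF K _ _ this]
  have "perforated_disc_iso K (cball 0 (1 / R)) (\<lambda>z. \<Phi> z / of_real R) (\<lambda>w. \<Psi> (w * of_real R)) \<or>
    perforated_disc_iso K (cball 0 (1 / R)) (\<lambda>z. of_real (1 / R) / (\<Phi> z / of_real R))
      (\<lambda>w. \<Psi> (of_real (1 / R) / w * of_real R))"
    using R by simp
  then show thesis
  proof
    \<comment> \<open>In this case the inversion exchanges the ends the wrong way. Following it with
      the involution gives \<open>\<Phi> z / R\<close>, as \<open>(1 / R) / (1 / \<Phi> z)\<close>
      simplifies to this.\<close>
    assume "perforated_disc_iso K (cball 0 (1 / R)) (\<lambda>z. \<Phi> z / of_real R) (\<lambda>w. \<Psi> (w * of_real R))"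
    moreover have "(\<lambda>w. 1 / of_real R / w) \<circ> inversion \<circ> \<Phi> = (\<lambda>z. \<Phi> z / of_real R)"
      by (auto simp: inversion_def)
    moreover have "(\<lambda>w. 1 / of_real R / w) holomorphic_on ?B"
      by (intro holomorphic_intros) (use B0 R in auto)
    moreover have "inj_on (\<lambda>w. 1 / of_real R / w) ?B"
      using inv(2) by (metis inj_onI)
    moreover have "(\<lambda>w. 1 / of_real R / w) ` ?B = ?B"
    proof
      show "?B \<subseteq> (\<lambda>w. 1 / of_real R / w) ` ?B" using inv by (metis image_eqI subsetI)
    qed (use inv in blast)
    ultimately show thesis using that[of "\<lambda>w. 1 / of_real R / w"] by (metis img)
  next
    \<comment> \<open>The factors \<open>R\<close> cancel, so this map is the inversion after
      \<open>\<Phi>\<close> and needs no correction.\<close>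
    assume "perforated_disc_iso K (cball 0 (1 / R)) (\<lambda>z. of_real (1 / R) / (\<Phi> z / of_real R))
      (\<lambda>w. \<Psi> (of_real (1 / R) / w * of_real R))"
    moreover have "(\<lambda>w. w) \<circ> inversion \<circ> \<Phi> = (\<lambda>z. of_real (1 / R) / (\<Phi> z / of_real R))"
      using R by (auto simp: inversion_def)
    ultimately show thesis using that[of "\<lambda>w. w"] by (simp add: img)
  qed
qed

section \<open>Holomorphic homeomorphisms and affine renormalization\<close>

lemma holomorphic_homeomorphism_compose:
  assumes "holomorphic_homeomorphism f S T" "holomorphic_homeomorphism g T U"
  shows "holomorphic_homeomorphism (g \<circ> f) S U"
proof -
  obtain f' g' where f: "homeomorphism S T f f'" "homeomorphism T U g g'"
    using assms unfolding holomorphic_homeomorphism_def by blast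
  have "f ` S \<subseteq> T" using f(1) unfolding homeomorphism_def by blast
  then have "g \<circ> f holomorphic_on S"
    using assms unfolding holomorphic_homeomorphism_def by (blast intro: holomorphic_on_compose_gen)
  then show ?thesis
    using homeomorphism_compose[OF f] unfolding holomorphic_homeomorphism_def by blast
qed

lemma holomorphic_homeomorphismI:
  assumes "f holomorphic_on S" "g holomorphic_on T"
    and "\<And>z. z \<in> S \<Longrightarrow> f z \<in> T \<and> g (f z) = z" "\<And>w. w \<in> T \<Longrightarrow> g w \<in> S \<and> f (g w) = w"
  shows "holomorphic_homeomorphism f S T"
  unfolding holomorphic_homeomorphism_def
proof
  have "homeomorphism S T f g"
    using assms by (intro homeomorphismI) (auto intro: holomorphic_on_imp_continuous_on)
  then show "\<exists>g. homeomorphism S T f g" by blast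
qed fact

lemma uniform_limit_affine:
  fixes f :: "nat \<Rightarrow> 'a \<Rightarrow> complex"
  assumes f: "uniform_limit C f l sequentially" and l: "bounded (l ` C)"
    and a: "a \<longlonglongrightarrow> a0" and b: "b \<longlonglongrightarrow> b0"
  shows "uniform_limit C (\<lambda>n z. a n * f n z + b n) (\<lambda>z. a0 * l z + b0) sequentially"
proof -
  have const: "uniform_limit C (\<lambda>n z. c n) (\<lambda>z. c0) sequentially" if "c \<longlonglongrightarrow> c0" for c and c0 :: complex
    using that unfolding uniform_limit_iff tendsto_iff by (auto elim: eventually_mono)
  have "bounded ((\<lambda>z. a0) ` C)" by (auto intro: bounded_subset[of "{a0}"])
  then show ?thesis
    by (intro uniform_limit_add uniform_lim_mult const a b f l)
qed

text \<open>An affine map after \<open>j\<close> keeps injectivity and the round shape of the image,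
  and its two coefficients are exactly what is needed to prescribe value and derivative at
  \<open>z0\<close>.\<close>

lemma normalizing_map_affine_compose:
  fixes \<Phi> j :: "complex \<Rightarrow> complex"
  defines "G \<equiv> j \<circ> inversion \<circ> \<Phi>"
  assumes j: "j holomorphic_on inversion ` E" "inj_on j (inversion ` E)"
    "j ` inversion ` E = round_annulus 0 r R" and r: "0 < r" "r < R"
    and G: "G field_differentiable at z0" "deriv G z0 \<noteq> 0" and \<zeta>: "deriv \<zeta> z0 \<noteq> 0"
  shows "normalizing_map E \<Phi> z0 \<zeta> \<xi>0
    (\<lambda>w. deriv \<zeta> z0 / deriv G z0 * j w + (\<xi>0 - deriv \<zeta> z0 / deriv G z0 * G z0))"
proof -
  define a where "a = deriv \<zeta> z0 / deriv G z0"
  define b where "b = \<xi>0 - a * G z0"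
  have a0: "a \<noteq> 0" using G \<zeta> by (simp add: a_def)
  have comp: "(\<lambda>w. a * j w + b) \<circ> inversion \<circ> \<Phi> = (\<lambda>z. a * G z + b)" by (auto simp: G_def)
  have "(\<lambda>w. a * j w + b) ` inversion ` E = (\<lambda>w. a * w + b) ` j ` inversion ` E" by (auto simp: image_image)
  also have "\<dots> = round_annulus b (norm a * r) (norm a * R)"
    unfolding j(3) by (rule affine_image_round_annulus[OF a0])
  finally have img: "(\<lambda>w. a * j w + b) ` inversion ` E = round_annulus b (norm a * r) (norm a * R)" .
  have "((\<lambda>z. a * G z + b) has_field_derivative a * deriv G z0) (at z0)"
    using G(1) by (auto intro!: derivative_eq_intros simp: field_differentiable_derivI)
  then have "deriv (\<lambda>z. a * G z + b) z0 = a * deriv G z0" by (rule DERIV_imp_deriv)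
  also have "\<dots> = deriv \<zeta> z0" using G by (simp add: a_def)
  finally have "deriv (\<lambda>z. a * G z + b) z0 / deriv \<zeta> z0 = 1" using \<zeta> by simp
  moreover have "(\<lambda>w. a * j w + b) holomorphic_on inversion ` E" by (intro holomorphic_intros j)
  moreover have "inj_on (\<lambda>w. a * j w + b) (inversion ` E)" using j(2) a0 by (auto simp: inj_on_def)
  moreover have "a * G z0 + b = \<xi>0" by (simp add: b_def)
  moreover have "0 < norm a * r" "norm a * r < norm a * R" using a0 r by auto
  ultimately have "normalizing_map E \<Phi> z0 \<zeta> \<xi>0 (\<lambda>w. a * j w + b)"
    unfolding normalizing_map_def comp using img by blast
  then show ?thesis by (simp add: a_def b_def)
qed

text \<open>The Riemann map \<open>f\<close> turns the shrinking sets \<open>closure (D n)\<close>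
  into perforations of the disk around 0, so that the rotation result applies. The limit is given
  explicitly by \<open>f\<close> and the data at \<open>z0\<close>.\<close>

lemma shrinking_annuli_normalized_limit:
  fixes \<Omega> :: "complex set" and D A E :: "nat \<Rightarrow> complex set" and R :: "nat \<Rightarrow> real"
    and \<Phi> :: "nat \<Rightarrow> complex \<Rightarrow> complex"
  assumes \<Omega>: "open \<Omega>" and f: "f holomorphic_on \<Omega>" and g: "g holomorphic_on ball 0 1" and f0: "f p0 = 0"
    and fg: "\<And>z. z \<in> \<Omega> \<Longrightarrow> f z \<in> ball 0 1 \<and> g (f z) = z"
    and gf: "\<And>z. z \<in> ball 0 1 \<Longrightarrow> g z \<in> \<Omega> \<and> f (g z) = z"
    and D\<Omega>: "\<And>n. closure (D n) \<subseteq> \<Omega>" and Dmono: "\<And>n. D (Suc n) \<subseteq> D n"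
    and Dbdd: "\<And>n. bounded (D n)" and diam: "(\<lambda>n. diameter (D n)) \<longlonglongrightarrow> 0"
    and p0: "\<And>n. p0 \<in> D n"
    and A: "\<And>n. A n = \<Omega> - closure (D n)"
    and E: "\<And>n. E n = round_annulus 0 1 (R n)"
    and \<Phi>: "\<And>n. holomorphic_homeomorphism (\<Phi> n) (A n) (E n)"
    and z0: "z0 \<in> A 0" and \<zeta>: "local_parameter z0 \<zeta>"
  shows "normalized_subsequence_limit (\<Omega> - {p0}) E \<Phi> z0 \<zeta> \<xi>0
    (\<lambda>z. \<xi>0 + deriv \<zeta> z0 / deriv f z0 * (f z - f z0))"
proof -
  have p0\<Omega>: "p0 \<in> \<Omega>" using p0[of 0] D\<Omega>[of 0] closure_subset by blast
  have openA: "open (A n)" for n unfolding A using \<Omega> by (simp add: open_Diff)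
  have z0A: "z0 \<in> A n" for n
  proof -
    have "D n \<subseteq> D 0" by (rule lift_Suc_antimono_le[of D 0 n]) (use Dmono in auto)
    then show ?thesis using z0 closure_mono unfolding A by blast
  qed
  then have z0\<Omega>: "z0 \<in> \<Omega>" "z0 \<noteq> p0" using p0[of 0] closure_subset unfolding A by blast+
  have \<Phi>A: "\<Phi> n ` A n = E n" for n
    using \<Phi>[of n] unfolding holomorphic_homeomorphism_def homeomorphism_def by blast
  have R: "1 < R n" for n
  proof -
    have "\<Phi> n z0 \<in> E n" using \<Phi>A z0A by blast
    then show ?thesis unfolding E round_annulus_def by auto
  qed
  have distD: "dist p0 x \<le> diameter (D n)" if "x \<in> closure (D n)" for x n
    using diameter_bounded_bound[of "closure (D n)" p0 x] p0[of n] closure_subset that Dbdd[of n]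
    by (auto simp: diameter_closure subset_iff)
  have evA: "\<forall>\<^sub>F n in sequentially. C \<subseteq> A n" if C: "compact C" "C \<subseteq> \<Omega> - {p0}" for C
  proof -
    have "open (- C)" "p0 \<in> - C" using C by (auto simp: compact_imp_closed)
    then obtain \<delta> where \<delta>: "\<delta> > 0" "ball p0 \<delta> \<subseteq> - C" using open_contains_ball by blast
    have "\<forall>\<^sub>F n in sequentially. diameter (D n) < \<delta>" using diam \<delta> by (intro order_tendstoD) auto
    then show ?thesis
    proof eventually_elim
      case (elim n)
      have "closure (D n) \<subseteq> ball p0 \<delta>" using distD[of _ n] elim by force
      then show ?case using C \<delta> unfolding A by blast
    qed
  qed

  define K where "K = (\<lambda>n. f ` closure (D n))"
  have compD: "compact (closure (D n))" for n using Dbdd by (simp add: compact_closure)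
  have contf: "continuous_on \<Omega> f" using f by (rule holomorphic_on_imp_continuous_on)
  have K: "compact (K n)" "0 \<in> K n" "K n \<subseteq> ball 0 1" for n
  proof -
    show "compact (K n)" unfolding K_def
      using contf D\<Omega> compD by (intro compact_continuous_image) (auto intro: continuous_on_subset)
    have "p0 \<in> closure (D n)" using p0[of n] closure_subset by blast
    then show "0 \<in> K n" using f0 unfolding K_def by (metis imageI)
    show "K n \<subseteq> ball 0 1" using fg D\<Omega> unfolding K_def by blast
  qed
  \<comment> \<open>A point where the modulus of \<open>f\<close> is maximal bounds
    \<open>K n\<close>. These points tend to \<open>p0\<close>, so the bounds tend to
    \<open>norm (f p0) = 0\<close>; the extra \<open>inverse (real (Suc n))\<close> makes the
    enclosing ball open.\<close>
  have "\<exists>d\<in>closure (D n). \<forall>x\<in>closure (D n). norm (f x) \<le> norm (f d)" for n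
  proof (rule continuous_attains_sup[OF compD])
    show "closure (D n) \<noteq> {}" using p0[of n] closure_subset by blast
    show "continuous_on (closure (D n)) (\<lambda>x. norm (f x))"
      using contf D\<Omega> by (intro continuous_intros) (auto intro: continuous_on_subset)
  qed
  then obtain d where d: "\<And>n. d n \<in> closure (D n)"
      "\<And>n x. x \<in> closure (D n) \<Longrightarrow> norm (f x) \<le> norm (f (d n))" by metis
  have "d \<longlonglongrightarrow> p0"
  proof (rule tendstoI)
    fix e :: real assume "e > 0"
    then have "\<forall>\<^sub>F n in sequentially. diameter (D n) < e" using diam by (intro order_tendstoD) auto
    then show "\<forall>\<^sub>F n in sequentially. dist (d n) p0 < e"
      using distD[OF d(1)] by (auto elim!: eventually_mono simp: dist_commute intro: le_less_trans)
  qed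
  moreover have "isCont f p0" using contf \<Omega> p0\<Omega> by (simp add: continuous_on_eq_continuous_at)
  ultimately have "(\<lambda>n. f (d n)) \<longlonglongrightarrow> 0" using isCont_tendsto_compose f0 by metis
  then have \<epsilon>: "(\<lambda>n. norm (f (d n)) + inverse (real (Suc n))) \<longlonglongrightarrow> 0"
    using tendsto_add[OF tendsto_norm_zero LIMSEQ_inverse_real_of_nat] by force
  have K\<epsilon>: "K n \<subseteq> ball 0 (norm (f (d n)) + inverse (real (Suc n)))" for n
  proof
    fix z assume "z \<in> K n"
    then have "norm z \<le> norm (f (d n))" using d(2) unfolding K_def by blast
    moreover have "0 < inverse (real (Suc n))" by simp
    ultimately show "z \<in> ball 0 (norm (f (d n)) + inverse (real (Suc n)))"
      unfolding mem_ball_0 by linarith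
  qed

  have fA: "f z \<in> ball 0 1 - K n" if "z \<in> A n" for z n
  proof -
    have "f z \<noteq> f x" if "x \<in> closure (D n)" for x
      using fg[of z] fg[of x] \<open>z \<in> A n\<close> that D\<Omega>[of n] unfolding A by (metis Diff_iff subsetD)
    then show ?thesis using fg[of z] that unfolding A K_def by blast
  qed
  have gA: "g w \<in> A n" if "w \<in> ball 0 1 - K n" for w n
    using gf[of w] that unfolding A K_def by (metis DiffD1 DiffD2 DiffI imageI)
  have "holomorphic_homeomorphism g (ball 0 1 - K n) (A n)" for n
  proof (rule holomorphic_homeomorphismI[of _ _ f])
    show "g holomorphic_on ball 0 1 - K n" using g by (rule holomorphic_on_subset) auto
    show "f holomorphic_on A n" using f by (rule holomorphic_on_subset) (auto simp: A)
    show "g w \<in> A n \<and> f (g w) = w" if "w \<in> ball 0 1 - K n" for w using gA[OF that] gf that by blast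
    show "f z \<in> ball 0 1 - K n \<and> g (f z) = z" if "z \<in> A n" for z
      using fA[OF that] fg[of z] that unfolding A by blast
  qed
  from holomorphic_homeomorphism_compose[OF this \<Phi>]
  have \<Phi>g: "holomorphic_homeomorphism (\<Phi> n \<circ> g) (ball 0 1 - K n) (E n)" for n .
  have "\<exists>j L. j holomorphic_on inversion ` E n \<and> inj_on j (inversion ` E n) \<and>
      j ` inversion ` E n = round_annulus 0 (1 / R n) 1 \<and>
      perforated_disc_iso (K n) (cball 0 (1 / R n)) (j \<circ> inversion \<circ> (\<Phi> n \<circ> g)) L" for n
    using oriented_annulus_map[OF K R \<Phi>g[unfolded E]] unfolding E by metis
  then obtain j L where j: "\<And>n. j n holomorphic_on inversion ` E n"
      "\<And>n. inj_on (j n) (inversion ` E n)"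
      "\<And>n. j n ` inversion ` E n = round_annulus 0 (1 / R n) 1"
      and iso: "\<And>n. perforated_disc_iso (K n) (cball 0 (1 / R n)) (j n \<circ> inversion \<circ> (\<Phi> n \<circ> g)) (L n)"
    by metis
  \<comment> \<open>The same maps appear in two coordinates: \<open>G n\<close> on
    \<open>A n\<close>, where the normalization at \<open>z0\<close> lives, and
    \<open>H n = G n \<circ> g\<close> on the perforated disk, where the limit is taken.\<close>
  define G where "G = (\<lambda>n. j n \<circ> inversion \<circ> \<Phi> n)"
  define H where "H = (\<lambda>n. j n \<circ> inversion \<circ> (\<Phi> n \<circ> g))"
  have E0: "w \<noteq> 0" if "w \<in> E n" for w n using that unfolding E round_annulus_def by auto
  have inv_hol: "inversion holomorphic_on E n" for n
    unfolding inversion_def using E0 by (intro holomorphic_intros) auto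
  have inv_inj: "inj_on inversion (E n)" for n by (auto simp: inj_on_def inversion_def)
  have Ghol: "G n holomorphic_on A n" for n
  proof -
    have "inversion \<circ> \<Phi> n holomorphic_on A n"
      using \<Phi>[of n] \<Phi>A[of n] by (intro holomorphic_on_compose_gen[OF _ inv_hol])
        (auto simp: holomorphic_homeomorphism_def)
    then have "j n \<circ> (inversion \<circ> \<Phi> n) holomorphic_on A n"
      using \<Phi>A[of n] by (intro holomorphic_on_compose_gen[OF _ j(1)]) auto
    then show ?thesis by (simp add: G_def o_assoc)
  qed
  have Ginj: "inj_on (G n) (A n)" for n
  proof -
    have "inj_on (\<Phi> n) (A n)"
      using \<Phi>[of n] unfolding holomorphic_homeomorphism_def homeomorphism_def by (metis inj_onI)
    then have "inj_on (inversion \<circ> \<Phi> n) (A n)" using inv_inj \<Phi>A by (intro comp_inj_on) auto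
    moreover have "(inversion \<circ> \<Phi> n) ` A n = inversion ` E n" using \<Phi>A by (metis image_comp)
    ultimately have "inj_on (j n \<circ> (inversion \<circ> \<Phi> n)) (A n)"
      using j(2)[of n] by (metis comp_inj_on)
    then show ?thesis by (simp add: G_def o_assoc)
  qed
  have Gd: "G n field_differentiable at z0" "deriv (G n) z0 \<noteq> 0" for n
    using holomorphic_on_imp_differentiable_at[OF Ghol openA z0A]
      holomorphic_injective_imp_regular[OF Ghol openA Ginj z0A] by auto
  have GH: "G n z = H n (f z)" if "z \<in> A n" for n z
    using fg[of z] that unfolding A by (simp add: G_def H_def)
  have HG: "H n = G n \<circ> g" for n by (auto simp: H_def G_def)
  have Hhol: "H n holomorphic_on ball 0 1 - K n" for n
    unfolding HG using gA g by (intro holomorphic_on_compose_gen[OF _ Ghol])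
      (auto intro: holomorphic_on_subset)
  have isoH: "perforated_disc_iso (K n) (cball 0 (1 / R n)) (H n) (L n)" for n
    unfolding H_def by (rule iso)
  obtain s \<alpha> where s: "strict_mono (s :: nat \<Rightarrow> nat)" and \<alpha>: "norm \<alpha> = 1"
    and limH: "\<And>C. compact C \<Longrightarrow> C \<subseteq> ball 0 1 - {0} \<Longrightarrow>
      uniform_limit C (H \<circ> s) (\<lambda>z. \<alpha> * z) sequentially"
    using perforated_disc_iso_limit[OF isoH K\<epsilon> \<epsilon> Hhol] by metis
  have limG: "uniform_limit C (\<lambda>k. G (s k)) (\<lambda>z. \<alpha> * f z) sequentially"
    if C: "compact C" "C \<subseteq> \<Omega> - {p0}" for C
  proof -
    have "f z \<noteq> 0" if "z \<in> C" for z
      using fg[of z] fg[of p0] that C(2) p0\<Omega> f0 by (metis Diff_iff singletonI subsetD)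
    moreover have "f z \<in> ball 0 1" if "z \<in> C" for z using fg[of z] C(2) that by auto
    ultimately have fC: "f ` C \<subseteq> ball 0 1 - {0}" by auto
    have "continuous_on C f" using contf C(2) by (rule continuous_on_subset[OF _ order_trans]) auto
    then have "compact (f ` C)" using C(1) by (rule compact_continuous_image)
    then have "uniform_limit C (\<lambda>n x. (H \<circ> s) n (f x)) (\<lambda>x. \<alpha> * f x) sequentially"
      using fC by (intro uniform_limit_compose'[OF limH]) auto
    moreover have "\<forall>\<^sub>F n in sequentially. \<forall>x\<in>C. (H \<circ> s) n (f x) = G (s n) x"
      using eventually_subseq[OF s evA[OF C]] by eventually_elim (use GH in auto)
    ultimately show ?thesis
      using uniform_limit_cong[of C "\<lambda>n x. (H \<circ> s) n (f x)" "\<lambda>n. G (s n)" sequentially] by blast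
  qed
  have \<alpha>0: "\<alpha> \<noteq> 0" using \<alpha> by auto
  have "inj_on f \<Omega>" using fg by (metis inj_onI)
  then have f': "deriv f z0 \<noteq> 0" using holomorphic_injective_imp_regular[OF f \<Omega>] z0\<Omega> by blast
  have \<zeta>': "deriv \<zeta> z0 \<noteq> 0"
    using \<zeta> holomorphic_injective_imp_regular unfolding local_parameter_def by blast
  have "open (\<Omega> - {p0})" "z0 \<in> \<Omega> - {p0}" using \<Omega> z0\<Omega> by auto
  then obtain \<delta> where \<delta>: "\<delta> > 0" "cball z0 \<delta> \<subseteq> \<Omega> - {p0}" using open_contains_cball by blast
  \<comment> \<open>Uniform convergence on a disk around \<open>z0\<close> passes to derivatives,
    which makes the normalizing coefficients converge.\<close>
  have "(\<lambda>k. deriv (G (s k)) z0) \<longlonglongrightarrow> deriv (\<lambda>z. \<alpha> * f z) z0"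
  proof (rule deriv_complex_uniform_limit)
    show "uniform_limit (ball z0 \<delta>) (\<lambda>k. G (s k)) (\<lambda>z. \<alpha> * f z) sequentially"
      using limG[OF compact_cball \<delta>(2)] by (rule uniform_limit_on_subset) auto
    show "\<forall>\<^sub>F k in sequentially. G (s k) holomorphic_on ball z0 \<delta>"
      using eventually_subseq[OF s evA[OF compact_cball \<delta>(2)]]
    proof eventually_elim
      case (elim k)
      have "ball z0 \<delta> \<subseteq> A (s k)" using elim ball_subset_cball by blast
      then show ?case using Ghol holomorphic_on_subset by blast
    qed
  qed (use \<delta> in auto)
  also have "deriv (\<lambda>z. \<alpha> * f z) z0 = \<alpha> * deriv f z0"
    using holomorphic_on_imp_differentiable_at[OF f \<Omega> z0\<Omega>(1)] by simp
  finally have limG': "(\<lambda>k. deriv (G (s k)) z0) \<longlonglongrightarrow> \<alpha> * deriv f z0" .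
  have limGz0: "(\<lambda>k. G (s k) z0) \<longlonglongrightarrow> \<alpha> * f z0"
    using tendsto_uniform_limitI[OF limG[of "{z0}"]] z0\<Omega> by auto
  define a where "a = (\<lambda>n. deriv \<zeta> z0 / deriv (G n) z0)"
  define b where "b = (\<lambda>n. \<xi>0 - a n * G n z0)"
  \<comment> \<open>The rotation factor \<open>\<alpha>\<close> in this denominator cancels the one
    in the limit \<open>\<alpha> * f\<close> of the maps.\<close>
  have a: "(\<lambda>k. a (s k)) \<longlonglongrightarrow> deriv \<zeta> z0 / (\<alpha> * deriv f z0)"
    unfolding a_def using limG' \<alpha>0 f' by (intro tendsto_intros) auto
  then have b: "(\<lambda>k. b (s k)) \<longlonglongrightarrow> \<xi>0 - deriv \<zeta> z0 / (\<alpha> * deriv f z0) * (\<alpha> * f z0)"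
    unfolding b_def using limGz0 by (intro tendsto_intros) auto
  have norml: "normalizing_map (E n) (\<Phi> n) z0 \<zeta> \<xi>0 (\<lambda>w. a n * j n w + b n)" for n
    unfolding a_def b_def G_def
    by (rule normalizing_map_affine_compose[OF j(1,2,3) _ _ Gd[unfolded G_def] \<zeta>'])
      (use R[of n] in auto)
  have lims: "locally_uniform_limit (\<Omega> - {p0})
      (\<lambda>k. (\<lambda>w. a (s k) * j (s k) w + b (s k)) \<circ> inversion \<circ> \<Phi> (s k))
      (\<lambda>z. \<xi>0 + deriv \<zeta> z0 / deriv f z0 * (f z - f z0))"
    unfolding locally_uniform_limit_def
  proof (intro allI impI)
    fix C assume C: "compact C \<and> C \<subseteq> \<Omega> - {p0}"
    have "compact ((\<lambda>z. \<alpha> * f z) ` C)"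
      using C contf by (intro compact_continuous_image continuous_intros) (auto intro: continuous_on_subset)
    then have "bounded ((\<lambda>z. \<alpha> * f z) ` C)" by (rule compact_imp_bounded)
    then have "uniform_limit C (\<lambda>k z. a (s k) * G (s k) z + b (s k))
        (\<lambda>z. deriv \<zeta> z0 / (\<alpha> * deriv f z0) * (\<alpha> * f z) +
          (\<xi>0 - deriv \<zeta> z0 / (\<alpha> * deriv f z0) * (\<alpha> * f z0))) sequentially"
      using C by (intro uniform_limit_affine a b limG) auto
    moreover have "deriv \<zeta> z0 / (\<alpha> * deriv f z0) * (\<alpha> * f z) +
          (\<xi>0 - deriv \<zeta> z0 / (\<alpha> * deriv f z0) * (\<alpha> * f z0)) =
        \<xi>0 + deriv \<zeta> z0 / deriv f z0 * (f z - f z0)" for z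
      using \<alpha>0 by (simp add: algebra_simps diff_divide_distrib)
    moreover have "(\<lambda>w. a n * j n w + b n) \<circ> inversion \<circ> \<Phi> n = (\<lambda>z. a n * G n z + b n)" for n
      by (auto simp: G_def)
    ultimately show "uniform_limit C (\<lambda>k. (\<lambda>w. a (s k) * j (s k) w + b (s k)) \<circ> inversion \<circ> \<Phi> (s k))
      (\<lambda>z. \<xi>0 + deriv \<zeta> z0 / deriv f z0 * (f z - f z0)) sequentially"
      by (simp only:)
  qed
  show ?thesis
    unfolding normalized_subsequence_limit_def
    by (rule exI[of _ "\<lambda>n w. a n * j n w + b n"], rule exI[of _ s]) (use norml s lims in blast)
qed

section \<open>The punctured disk as the image of the normalized limit\<close>

theorem theorem5p2:
  fixes \<Omega> \<Gamma> :: "complex set" and p0 z0 :: complex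
    and D \<Theta> A E :: "nat \<Rightarrow> complex set"
    and P Q :: "nat \<Rightarrow> nat \<Rightarrow> complex set"
    and T :: "nat \<Rightarrow> nat \<Rightarrow> nat \<Rightarrow> complex set set"
    and u :: "nat \<Rightarrow> complex \<Rightarrow> real"
    and \<phi> :: "nat \<Rightarrow> nat \<Rightarrow> complex \<Rightarrow> complex"
    and \<Phi> :: "nat \<Rightarrow> complex \<Rightarrow> complex"
  assumes "jordan_curve \<Gamma>" and "domain_bounded_by \<Omega> \<Gamma>" and "p0 \<in> \<Omega>"
    and "\<And>n. polygonal_jordan_curve (\<Theta> n)" and "\<And>n. domain_bounded_by (D n) (\<Theta> n)"
    and "\<And>n. closure (D n) \<subseteq> \<Omega>"
    and "\<And>n. D (Suc n) \<subseteq> D n"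
    and "(\<lambda>n. diameter (D n)) \<longlonglongrightarrow> 0" and "(\<Inter>n. D n) = {p0}"
    and "\<And>n. A n = \<Omega> - closure (D n)"
    \<comment> \<open>exhaustion of \<open>A n\<close> by triangulated polygonal annuli;
        if \<open>\<Gamma>\<close> is polygonal, \<open>P n j = \<Gamma>\<close> and \<open>Q n j = \<Theta> n\<close> is a possible choice\<close>
    and "\<And>n j. polygonal_annulus (P n j) (Q n j)"
    and "\<And>n j. D n \<subseteq> inside (Q n j)"
    and "\<And>n j. annulus_of (P n j) (Q n j) \<subseteq> annulus_of (P n (Suc j)) (Q n (Suc j))"
    and "\<And>n. (\<Union>j. annulus_of (P n j) (Q n j)) = A n"
    and "\<And>n j. admissible_triangulations (P n j) (Q n j) (T n j)"
    and "\<And>n. harmonic_on (A n) (u n)" and "\<And>n. continuous_on (closure (A n)) (u n)"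
    and "\<And>n z. z \<in> \<Gamma> \<Longrightarrow> u n z = 1" and "\<And>n z. z \<in> \<Theta> n \<Longrightarrow> u n z = 0"
    and "\<And>n. E n = round_annulus 0 1 (exp (2 * pi / conjugate_period (A n) (D n) (u n)))"
    and "\<And>n. holomorphic_homeomorphism (\<Phi> n) (A n) (E n)"
    and "\<And>n j. limit_of_discrete_maps (P n j) (Q n j) (T n j) (\<phi> n j)"
    and "\<And>n. locally_uniform_limit (A n) (\<phi> n) (\<Phi> n)"
    and "z0 \<in> A 0"
  shows
    \<comment> \<open>The normalizing data can be chosen so that the limit is onto the punctured unit disk,
        and for arbitrary data it is onto a punctured round disk.\<close>
    "(\<exists>\<zeta> \<xi>0 \<Psi>. local_parameter z0 \<zeta> \<and>
        normalized_subsequence_limit (\<Omega> - {p0}) E \<Phi> z0 \<zeta> \<xi>0 \<Psi> \<and>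
        holomorphic_homeomorphism \<Psi> (\<Omega> - {p0}) (ball 0 1 - {0}) \<and>
        (\<exists>\<Psi>'. \<Psi>' holomorphic_on \<Omega> \<and> (\<forall>z\<in>\<Omega> - {p0}. \<Psi>' z = \<Psi> z)))
     \<and> (\<forall>\<zeta> \<xi>0. local_parameter z0 \<zeta> \<longrightarrow>
        (\<exists>\<Psi> c \<rho>. 0 < \<rho> \<and>
          normalized_subsequence_limit (\<Omega> - {p0}) E \<Phi> z0 \<zeta> \<xi>0 \<Psi> \<and>
          holomorphic_homeomorphism \<Psi> (\<Omega> - {p0}) (ball c \<rho> - {c}) \<and>
          (\<exists>\<Psi>'. \<Psi>' holomorphic_on \<Omega> \<and> (\<forall>z\<in>\<Omega> - {p0}. \<Psi>' z = \<Psi> z))))"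
proof -
  have p0D: "p0 \<in> D n" for n using assms(9) by blast
  have \<Omega>: "open \<Omega>" "simply_connected \<Omega>" "\<Omega> \<noteq> UNIV"
    using assms(2) not_bounded_UNIV unfolding domain_bounded_by_def by auto
  obtain f g where f: "f holomorphic_on \<Omega>" and g: "g holomorphic_on ball 0 1" and f0: "f p0 = 0"
    and fg: "\<And>z. z \<in> \<Omega> \<Longrightarrow> f z \<in> ball 0 1 \<and> g (f z) = z"
    and gf: "\<And>z. z \<in> ball 0 1 \<Longrightarrow> g z \<in> \<Omega> \<and> f (g z) = z"
    using Riemann_map_at[OF \<Omega> assms(3)] by metis
  have z0: "z0 \<in> \<Omega>" using assms(10,24) by blast
  have "inj_on f \<Omega>" using fg by (metis inj_onI)
  then have f': "deriv f z0 \<noteq> 0" using holomorphic_injective_imp_regular[OF f \<Omega>(1)] z0 by blast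
  have Dbdd: "bounded (D n)" for n using assms(5) unfolding domain_bounded_by_def by blast
  have lim: "normalized_subsequence_limit (\<Omega> - {p0}) E \<Phi> z0 \<zeta> \<xi>0
      (\<lambda>z. \<xi>0 + deriv \<zeta> z0 / deriv f z0 * (f z - f z0))" if "local_parameter z0 \<zeta>" for \<zeta> \<xi>0
    by (rule shrinking_annuli_normalized_limit[OF \<Omega>(1) f g f0 fg gf assms(6,7) Dbdd assms(8) p0D
          assms(10,20,21,24) that])
  have g0: "g 0 = p0" using fg[OF assms(3)] f0 by simp
  have hom: "holomorphic_homeomorphism f (\<Omega> - {p0}) (ball 0 1 - {0})"
  proof (rule holomorphic_homeomorphismI[of _ _ g])
    show "f z \<in> ball 0 1 - {0} \<and> g (f z) = z" if "z \<in> \<Omega> - {p0}" for z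
      using fg[of z] that g0 by auto
    show "g w \<in> \<Omega> - {p0} \<and> f (g w) = w" if "w \<in> ball 0 1 - {0}" for w
      using gf[of w] that f0 by auto
  qed (auto intro: holomorphic_on_subset f g)
  have affine: "holomorphic_homeomorphism (\<lambda>w. a * w + c) (ball 0 1 - {0}) (ball c (norm a) - {c})"
    if "a \<noteq> 0" for a c :: complex
  proof (rule holomorphic_homeomorphismI[of _ _ "\<lambda>w. (w - c) / a"])
    show "a * z + c \<in> ball c (norm a) - {c} \<and> (a * z + c - c) / a = z" if "z \<in> ball 0 1 - {0}" for z
      using that \<open>a \<noteq> 0\<close> by (auto simp: dist_norm norm_mult)
    show "(w - c) / a \<in> ball 0 1 - {0} \<and> a * ((w - c) / a) + c = w" if "w \<in> ball c (norm a) - {c}" for w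
      using that \<open>a \<noteq> 0\<close> by (auto simp: dist_norm norm_divide norm_minus_commute)
  qed (use that in \<open>auto intro!: holomorphic_intros\<close>)
  show ?thesis
  proof (intro conjI allI impI)
    \<comment> \<open>With \<open>deriv f z0\<close> as the derivative of the parameter and
      \<open>f z0\<close> as the prescribed value, the explicit limit is the Riemann map
      \<open>f\<close> itself.\<close>
    define \<zeta> where "\<zeta> = (\<lambda>z. deriv f z0 * (z - z0))"
    have "(\<zeta> has_field_derivative deriv f z0) (at z0)"
      unfolding \<zeta>_def by (auto intro!: derivative_eq_intros)
    then have \<zeta>': "deriv \<zeta> z0 = deriv f z0" by (rule DERIV_imp_deriv)
    have \<zeta>: "local_parameter z0 \<zeta>"
      unfolding local_parameter_def \<zeta>_def using f'
      by (auto intro!: exI[of _ UNIV] holomorphic_intros simp: inj_on_def)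
    have "(\<lambda>z. f z0 + deriv \<zeta> z0 / deriv f z0 * (f z - f z0)) = f" using f' \<zeta>' by auto
    then have "normalized_subsequence_limit (\<Omega> - {p0}) E \<Phi> z0 \<zeta> (f z0) f"
      using lim[OF \<zeta>, of "f z0"] by simp
    then show "\<exists>\<zeta> \<xi>0 \<Psi>. local_parameter z0 \<zeta> \<and>
        normalized_subsequence_limit (\<Omega> - {p0}) E \<Phi> z0 \<zeta> \<xi>0 \<Psi> \<and>
        holomorphic_homeomorphism \<Psi> (\<Omega> - {p0}) (ball 0 1 - {0}) \<and>
        (\<exists>\<Psi>'. \<Psi>' holomorphic_on \<Omega> \<and> (\<forall>z\<in>\<Omega> - {p0}. \<Psi>' z = \<Psi> z))"
      using \<zeta> hom f by blast
  next
    fix \<zeta> \<xi>0 assume \<zeta>: "local_parameter z0 \<zeta>"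
    \<comment> \<open>For general data the limit is \<open>a * f z + c\<close>: the image disk has
      radius \<open>norm a\<close>, and its center \<open>c\<close> is the value at
      \<open>p0\<close>, where \<open>f\<close> vanishes.\<close>
    define a where "a = deriv \<zeta> z0 / deriv f z0"
    define c where "c = \<xi>0 - a * f z0"
    have "deriv \<zeta> z0 \<noteq> 0"
      using \<zeta> holomorphic_injective_imp_regular unfolding local_parameter_def by blast
    then have a0: "a \<noteq> 0" using f' by (simp add: a_def)
    define \<Psi> where "\<Psi> = (\<lambda>w. a * w + c) \<circ> f"
    have "(\<lambda>z. \<xi>0 + deriv \<zeta> z0 / deriv f z0 * (f z - f z0)) = \<Psi>"
      unfolding a_def[symmetric] by (auto simp: \<Psi>_def c_def algebra_simps)
    then have "normalized_subsequence_limit (\<Omega> - {p0}) E \<Phi> z0 \<zeta> \<xi>0 \<Psi>"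
      using lim[OF \<zeta>, of \<xi>0] by simp
    moreover have "holomorphic_homeomorphism \<Psi> (\<Omega> - {p0}) (ball c (norm a) - {c})"
      unfolding \<Psi>_def by (rule holomorphic_homeomorphism_compose[OF hom affine[OF a0]])
    moreover have "\<Psi> holomorphic_on \<Omega>"
      unfolding \<Psi>_def o_def by (intro holomorphic_intros f)
    moreover have "0 < norm a" using a0 by simp
    ultimately show "\<exists>\<Psi> c \<rho>. 0 < \<rho> \<and>
          normalized_subsequence_limit (\<Omega> - {p0}) E \<Phi> z0 \<zeta> \<xi>0 \<Psi> \<and>
          holomorphic_homeomorphism \<Psi> (\<Omega> - {p0}) (ball c \<rho> - {c}) \<and>
          (\<exists>\<Psi>'. \<Psi>' holomorphic_on \<Omega> \<and> (\<forall>z\<in>\<Omega> - {p0}. \<Psi>' z = \<Psi> z))"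
      by blast
  qed
qed

end
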